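(* Let $p \in (0,1)$, let $n\in\mathbb{N}$, and let $\mathcal{F} \subset \mathcal{P}([n])$ be a monotone increasing family. Let $\lambda \in [0,1]$ be such that $\mu_p^{(n)}(\mathcal{F}) = \mu_p^{(\mathbb{N})}(\mathcal{L}_\lambda)$. Then $$I^p[\mathcal{F}] \ge I^p[\mathcal{L}_\lambda],$$ where $I^p[\mathcal{F}]$ is defined in terms of the $p$-biased measure on $\mathcal{P}([n])$ and $I^p[\mathcal{L}_\lambda]$ is defined in terms of the $p$-biased measure on $\mathcal{P}(\mathbb{N})$.
   Context: $[n]=\{1,\dots,n\}$, $\mathbb{N}=\{1,2,\dots\}$, and $\mathcal{P}(X)$ is the power set of $X$. The $p$-biased measure on $\mathcal{P}([n])$ is $\mu_p^{(n)}(\{S\}) = p^{|S|}(1-p)^{n-|S|}$. $\Sigma$ is the $\sigma$-algebra on $\mathcal{P}(\mathbb{N})\cong\{0,1\}^{\mathbb{N}}$ generated by the families depending on only finitely many coordinates, and $\mu_p^{(\mathbb{N})}$ is the $p$-biased product measure on $(\mathcal{P}(\mathbb{N}),\Sigma)$ (each $j\in\mathbb{N}$ is included in the random set independently with probability $p$). A family $\mathcal{F}\subset\mathcal{P}([n])$ is monotone increasing if $S\in\mathcal{F}$ and $S\subset T\subset[n]$ imply $T\in\mathcal{F}$. Influences: for $\mathcal{F}\subset\mathcal{P}([n])$ and $i\in[n]$, $I_i^p[\mathcal{F}] := \Pr_{S\sim\mu_p^{(n)}}[\,|\mathcal{F}\cap\{S,S\Delta\{i\}\}|=1\,]$ and $I^p[\mathcal{F}]:=\sum_{i=1}^n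 I_i^p[\mathcal{F}]$. For $\mathcal{F}\in\Sigma$ and $i\in\mathbb{N}$, $I_i^p[\mathcal{F}] := \Pr_{S\sim\mu_p^{(\mathbb{N})}}[\,|\mathcal{F}\cap\{S,S\Delta\{i\}\}|=1\,]$ and $I^p[\mathcal{F}]:=\sum_{i=1}^\infty I_i^p[\mathcal{F}]$. Lexicographic families $\mathcal{L}_\lambda\subset\mathcal{P}(\mathbb{N})$: $\mathcal{L}_0=\emptyset$, $\mathcal{L}_1=\mathcal{P}(\mathbb{N})$. For $\lambda\in(0,1)$, let $\lambda=\sum_j 2^{-i_j}$ with $1\le i_1<i_2<\cdots$ be its binary expansion (the finite one if $\lambda$ is a dyadic rational), and define $\mathcal{L}_\lambda := \bigcup_j\{S\subset\mathbb{N} : S\cap[i_j] = [i_j]\setminus\{i_k : k<j\}\}$. (This is the initial segment, with $\mu_{1/2}^{(\mathbb{N})}$-measure $\lambda$, of the lexicographic ordering on $\mathcal{P}(\mathbb{N})$ given by $S>T$ iff $\min(S\Delta T)\in S$, initial segments consisting of the largest elements.) *)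

theory Defs
  imports "HOL-Probability.Probability"
begin

section \<open>Biased measures\<close>

text \<open>\<open>\<nat> = {1,2,...}\<close> is rendered as \<open>{1..} :: nat set\<close> throughout.\<close>

definition biased_fin :: "real \<Rightarrow> nat \<Rightarrow> nat set measure" where
  "biased_fin p n =
     point_measure (Pow {1..n}) (\<lambda>S. ennreal (p ^ card S * (1 - p) ^ (n - card S)))"

definition finitely_determined :: "nat set set \<Rightarrow> bool" where
  "finitely_determined F \<longleftrightarrow> F \<subseteq> Pow {1..} \<and>
     (\<exists>J. finite J \<and> J \<subseteq> {1..} \<and>
        (\<forall>S\<in>Pow {1..}. \<forall>T\<in>Pow {1..}. S \<inter> J = T \<inter> J \<longrightarrow> (S \<in> F \<longleftrightarrow> T \<in> F)))"

text \<open>The product of Bernoulli measures lives on functions \<open>{1..} \<Rightarrow> bool\<close>; it is transported to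
  \<open>Pow {1..}\<close> by identifying an indicator function with its set. Measurability of this map, without
  which \<^const>\<open>distr\<close> would be meaningless, is \<open>measurable_indicator_to_set\<close> below.\<close>

definition biased_seq :: "real \<Rightarrow> nat set measure" where
  "biased_seq p =
     distr (\<Pi>\<^sub>M j\<in>{1..}. measure_pmf (bernoulli_pmf p))
       (sigma (Pow {1..}) {F. finitely_determined F})
       (\<lambda>\<omega>. {j\<in>{1..}. \<omega> j})"

section \<open>Influences\<close>

definition monotone_increasing :: "nat \<Rightarrow> nat set set \<Rightarrow> bool" where
  "monotone_increasing n F \<longleftrightarrow> F \<subseteq> Pow {1..n} \<and>
     (\<forall>S T. S \<in> F \<longrightarrow> S \<subseteq> T \<longrightarrow> T \<subseteq> {1..n} \<longrightarrow> T \<in> F)"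

definition influence :: "nat set measure \<Rightarrow> nat set set \<Rightarrow> nat \<Rightarrow> real" where
  "influence M F i = measure M {S \<in> space M. card (F \<inter> {S, sym_diff S {i}}) = 1}"

definition total_influence_fin :: "real \<Rightarrow> nat \<Rightarrow> nat set set \<Rightarrow> real" where
  "total_influence_fin p n F = (\<Sum>i=1..n. influence (biased_fin p n) F i)"

text \<open>A family depending on infinitely many coordinates may have infinite total influence, so the
  sum is taken in \<^typ>\<open>ennreal\<close>.\<close>

definition total_influence_seq :: "real \<Rightarrow> nat set set \<Rightarrow> ennreal" where
  "total_influence_seq p F = (\<Sum>i. ennreal (influence (biased_seq p) F (Suc i)))"

section \<open>Lexicographic families\<close>

text \<open>The expansion \<open>x = (\<Sum>j. 2 powr - i\<^sub>j)\<close> is represented by its set of positions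
  \<open>B = {i\<^sub>1 < i\<^sub>2 < ...}\<close>. For \<open>x \<in> {0<..<1}\<close> there is exactly one such \<open>B\<close>, see
  \<open>ex1_is_binary_expansion\<close> below.\<close>

definition is_binary_expansion :: "real \<Rightarrow> nat set \<Rightarrow> bool" where
  "is_binary_expansion x B \<longleftrightarrow> B \<subseteq> {1..} \<and> ((\<lambda>i. (1/2) ^ i) has_sum x) B \<and>
     (x \<in> dyadics \<longrightarrow> finite B)"

definition binary_positions :: "real \<Rightarrow> nat set" where
  "binary_positions x = (THE B. is_binary_expansion x B)"

text \<open>With \<open>i = i\<^sub>j\<close>, the set \<open>{i\<^sub>k | k < j}\<close> is \<open>{k \<in> binary_positions x. k < i}\<close>.\<close>

definition lex_family :: "real \<Rightarrow> nat set set" where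
  "lex_family x =
     (if x = 0 then {}
      else if x = 1 then Pow {1..}
      else (\<Union>i\<in>binary_positions x.
              {S \<in> Pow {1..}. S \<inter> {1..i} = {1..i} - {k \<in> binary_positions x. k < i}}))"

section \<open>Well-definedness\<close>

lemma space_biased_fin [simp]: "space (biased_fin p n) = Pow {1..n}"
  and sets_biased_fin [simp]: "sets (biased_fin p n) = Pow (Pow {1..n})"
  by (simp_all add: biased_fin_def space_point_measure sets_point_measure)

lemma measure_biased_fin:
  assumes "0 \<le> p" "p \<le> 1" "F \<subseteq> Pow {1..n}"
  shows "measure (biased_fin p n) F = (\<Sum>S\<in>F. p ^ card S * (1 - p) ^ (n - card S))"
proof -
  have "finite F" using assms(3) by (rule finite_subset) simp
  then have "emeasure (biased_fin p n) F = ennreal (\<Sum>S\<in>F. p ^ card S * (1 - p) ^ (n - card S))"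
    using assms by (simp add: biased_fin_def emeasure_point_measure_finite sum_ennreal)
  then show ?thesis
    using assms by (simp add: measure_def sum_nonneg)
qed

lemma finitely_determinedD:
  assumes "finitely_determined F"
  shows "\<exists>J. finite J \<and> J \<subseteq> {1..} \<and> F \<subseteq> Pow {1..} \<and>
    (\<forall>S T. S \<subseteq> {1..} \<longrightarrow> T \<subseteq> {1..} \<longrightarrow> S \<inter> J = T \<inter> J \<longrightarrow> (S \<in> F \<longleftrightarrow> T \<in> F))"
  using assms unfolding finitely_determined_def by (metis PowI)

lemma finitely_determined_cylinder: "finitely_determined {S \<in> Pow {1..}. S \<inter> {1..n} = T}"
  unfolding finitely_determined_def
  by (intro conjI exI[of _ "{1..n}"] ballI impI) (simp_all, blast)

lemma finitely_determined_subset: "{F. finitely_determined F} \<subseteq> Pow (Pow {1..})"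
  by (auto simp: finitely_determined_def)

lemma space_biased_seq [simp]: "space (biased_seq p) = Pow {1..}"
  unfolding biased_seq_def space_distr by (rule space_measure_of[OF finitely_determined_subset])

lemma sets_biased_seq: "sets (biased_seq p) = sigma_sets (Pow {1..}) {F. finitely_determined F}"
  unfolding biased_seq_def sets_distr by (rule sets_measure_of[OF finitely_determined_subset])

lemma measurable_indicator_to_set:
  "(\<lambda>\<omega>. {j\<in>{1..}. \<omega> j}) \<in> (\<Pi>\<^sub>M j\<in>{1..}. measure_pmf (bernoulli_pmf p)) \<rightarrow>\<^sub>M
     sigma (Pow {1..}) {F. finitely_determined F}" (is "?f \<in> ?M \<rightarrow>\<^sub>M _")
proof (rule measurable_measure_of)
  fix F assume "F \<in> {F. finitely_determined F}"
  then have "finitely_determined F" by simp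
  from finitely_determinedD[OF this] obtain J where J: "finite J" "J \<subseteq> {1..}"
    and F1: "F \<subseteq> Pow {1..}"
    and F2: "\<forall>S T. S \<subseteq> {1..} \<longrightarrow> T \<subseteq> {1..} \<longrightarrow> S \<inter> J = T \<inter> J \<longrightarrow> (S \<in> F \<longleftrightarrow> T \<in> F)"
    by (elim exE conjE)
  note F = F1 F2[rule_format]
  have [measurable]: "(\<lambda>\<omega>. \<omega> j) \<in> ?M \<rightarrow>\<^sub>M count_space UNIV" if "j \<in> J" for j
  proof -
    have "j \<in> {1..}" using that J by auto
    then have "(\<lambda>\<omega>. \<omega> j) \<in> ?M \<rightarrow>\<^sub>M measure_pmf (bernoulli_pmf p)"
      by (rule measurable_component_singleton)
    then show ?thesis by (simp cong: measurable_cong_sets)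
  qed
  have "{\<omega> \<in> space ?M. \<forall>j\<in>J. \<omega> j = (j \<in> T)} \<in> sets ?M" for T
    by (rule sets.sets_Collect_finite_All[OF _ J(1)]) measurable
  then have *: "{\<omega> \<in> space ?M. ?f \<omega> \<inter> J = T \<inter> J} \<in> sets ?M" for T
    by (rule back_subst[of "\<lambda>A. A \<in> sets ?M"]) (use J in auto)
  have "?f -` F \<inter> space ?M = (\<Union>T\<in>F \<inter> Pow J. {\<omega> \<in> space ?M. ?f \<omega> \<inter> J = T \<inter> J})" (is "?L = ?R")
  proof (intro equalityI subsetI)
    fix \<omega> assume w: "\<omega> \<in> ?L"
    have "?f \<omega> \<inter> J \<in> F" using w F(2)[of "?f \<omega>" "?f \<omega> \<inter> J"] by auto
    then show "\<omega> \<in> ?R" using w by auto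
  next
    fix \<omega> assume "\<omega> \<in> ?R"
    then obtain T where T: "T \<in> F" "\<omega> \<in> space ?M" "?f \<omega> \<inter> J = T \<inter> J" by auto
    have "?f \<omega> \<in> F" using F(2)[of "?f \<omega>" T] T F(1) by auto
    then show "\<omega> \<in> ?L" using T by auto
  qed
  moreover have "?R \<in> sets ?M" using J * by (intro sets.finite_UN) auto
  ultimately show "?f -` F \<inter> space ?M \<in> sets ?M" by simp
qed (use finitely_determined_subset in auto)

lemma prob_space_biased_seq: "prob_space (biased_seq p)"
  unfolding biased_seq_def
  by (rule prob_space.prob_space_distr[OF _ measurable_indicator_to_set])
     (auto intro: prob_space_PiM measure_pmf.prob_space_axioms)

lemma emeasure_biased_seq_cylinder:
  assumes p: "0 \<le> p" "p \<le> 1" and T: "T \<subseteq> {1..n}"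
  shows "emeasure (biased_seq p) {S \<in> Pow {1..}. S \<inter> {1..n} = T} =
     ennreal (p ^ card T * (1 - p) ^ (n - card T))"
proof -
  interpret product_prob_space "\<lambda>_. measure_pmf (bernoulli_pmf p)" "{1..} :: nat set" ..
  let ?M = "\<Pi>\<^sub>M j\<in>{(1::nat)..}. measure_pmf (bernoulli_pmf p)"
  have "{S \<in> Pow {1..}. S \<inter> {1..n} = T} \<in> sets (biased_seq p)"
    unfolding sets_biased_seq by (intro sigma_sets.Basic CollectI finitely_determined_cylinder)
  then have "emeasure (biased_seq p) {S \<in> Pow {1..}. S \<inter> {1..n} = T} =
      emeasure ?M ((\<lambda>\<omega>. {j\<in>{1..}. \<omega> j}) -` {S \<in> Pow {1..}. S \<inter> {1..n} = T} \<inter> space ?M)"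
    unfolding biased_seq_def
    by (intro emeasure_distr measurable_indicator_to_set) simp
  also have "(\<lambda>\<omega>. {j\<in>{1..}. \<omega> j}) -` {S \<in> Pow {1..}. S \<inter> {1..n} = T} \<inter> space ?M =
      {\<omega> \<in> space ?M. \<forall>j\<in>{1..n}. \<omega> j \<in> {j \<in> T}}"
    using T by auto
  also have "emeasure ?M \<dots> = (\<Prod>j\<in>{1..n}. emeasure (measure_pmf (bernoulli_pmf p)) {j \<in> T})"
    by (rule emeasure_PiM_Collect) auto
  also have "\<dots> = (\<Prod>j\<in>{1..n}. ennreal (if j \<in> T then p else 1 - p))"
    using p by (intro prod.cong refl) (simp add: emeasure_pmf_single)
  also have "\<dots> = ennreal (\<Prod>j\<in>{1..n}. if j \<in> T then p else 1 - p)"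
    using p by (intro prod_ennreal) auto
  also have "(\<Prod>j\<in>{1..n}. if j \<in> T then p else 1 - p) = p ^ card T * (1 - p) ^ (n - card T)"
  proof -
    have "{1..n} \<inter> {j. j \<in> T} = T" "{1..n} \<inter> - {j. j \<in> T} = {1..n} - T" using T by auto
    moreover have "card ({1..n} - T) = n - card T"
      using T by (simp add: card_Diff_subset finite_subset)
    ultimately show ?thesis by (simp add: prod.If_cases)
  qed
  finally show ?thesis .
qed

lemma lex_family_in_sets: "lex_family x \<in> sets (biased_seq p)"
proof -
  interpret prob_space "biased_seq p" by (rule prob_space_biased_seq)
  have "{S \<in> Pow {1..}. S \<inter> {1..i} = A} \<in> sets (biased_seq p)" for i A
    unfolding sets_biased_seq
    by (intro sigma_sets.Basic CollectI finitely_determined_cylinder)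
  moreover have "Pow {1..} \<in> sets (biased_seq p)" using sets.top[of "biased_seq p"] by simp
  ultimately show ?thesis
    unfolding lex_family_def by (auto intro!: sets.countable_UN'')
qed

lemma pivotal_in_sets:
  assumes F: "F \<in> sets (biased_seq p)" and i: "i \<in> {1..}"
  shows "{S \<in> space (biased_seq p). card (F \<inter> {S, sym_diff S {i}}) = 1} \<in> sets (biased_seq p)"
proof -
  let ?g = "\<lambda>S. sym_diff S {i}"
  have "?g \<in> biased_seq p \<rightarrow>\<^sub>M sigma (Pow {1..}) {F. finitely_determined F}"
  proof (rule measurable_measure_of)
    fix A assume "A \<in> {F. finitely_determined F}"
    then have "finitely_determined A" by simp
    from finitely_determinedD[OF this] obtain J where J: "finite J" "J \<subseteq> {1..}"
      and A1: "A \<subseteq> Pow {1..}"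
      and A2: "\<forall>S T. S \<subseteq> {1..} \<longrightarrow> T \<subseteq> {1..} \<longrightarrow> S \<inter> J = T \<inter> J \<longrightarrow> (S \<in> A \<longleftrightarrow> T \<in> A)"
      by (elim exE conjE)
    note A = A1 A2[rule_format]
    have "finitely_determined (?g -` A \<inter> Pow {1..})"
      unfolding finitely_determined_def
    proof (intro conjI exI[of _ J] J ballI impI)
      show "?g -` A \<inter> Pow {1..} \<subseteq> Pow {1..}" by (rule Int_lower2)
      fix S T assume ST: "S \<in> Pow {1..}" "T \<in> Pow {1..}" "S \<inter> J = T \<inter> J"
      have "?g S \<inter> J = ?g T \<inter> J" using ST(3) by blast
      moreover have "?g S \<subseteq> {1..}" "?g T \<subseteq> {1..}" using ST i by auto
      ultimately have "?g S \<in> A \<longleftrightarrow> ?g T \<in> A" using A(2) by blast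
      then show "S \<in> ?g -` A \<inter> Pow {1..} \<longleftrightarrow> T \<in> ?g -` A \<inter> Pow {1..}" using ST by simp
    qed
    then show "?g -` A \<inter> space (biased_seq p) \<in> sets (biased_seq p)"
      unfolding sets_biased_seq space_biased_seq by (intro sigma_sets.Basic CollectI)
  qed (use finitely_determined_subset i in auto)
  moreover have "F \<in> sets (sigma (Pow {1..}) {F. finitely_determined F})"
    using F unfolding sets_biased_seq sets_measure_of[OF finitely_determined_subset] .
  ultimately have gF: "?g -` F \<inter> space (biased_seq p) \<in> sets (biased_seq p)"
    by (rule measurable_sets)
  have *: "card (F \<inter> {S, ?g S}) = 1 \<longleftrightarrow> (S \<in> F) \<noteq> (?g S \<in> F)" for S
  proof -
    have "S \<noteq> ?g S" by auto
    then show ?thesis by (cases "S \<in> F"; cases "?g S \<in> F") (auto simp: Int_insert_right)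
  qed
  have "{S \<in> space (biased_seq p). card (F \<inter> {S, ?g S}) = 1} =
      sym_diff F (?g -` F \<inter> space (biased_seq p))"
    unfolding * using sets.sets_into_space[OF F] by auto
  then show ?thesis using F gF by (simp only:) auto
qed

lemma has_sum_half_tail: "((\<lambda>i. (1/2::real) ^ i) has_sum (1/2) ^ j) {j<..}"
proof -
  have "(\<lambda>i. (1/2::real) ^ Suc j * (1/2) ^ i) sums ((1/2) ^ Suc j * (1 / (1 - 1/2)))"
    by (intro sums_mult geometric_sums) simp
  then have "((\<lambda>i. (1/2::real) ^ Suc j * (1/2) ^ i) has_sum (1/2) ^ Suc j * (1 / (1 - 1/2))) UNIV"
    by (rule sums_nonneg_imp_has_sum) simp
  then have *: "((\<lambda>i. (1/2::real) ^ i) \<circ> (\<lambda>i. Suc j + i) has_sum (1/2) ^ j) UNIV"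
    by (simp add: o_def power_add)
  have "bij_betw (\<lambda>i. Suc j + i) UNIV {j<..}"
    by (rule bij_betwI[where g = "\<lambda>i. i - Suc j"]) auto
  then have "inj (\<lambda>i. Suc j + i)" "range (\<lambda>i. Suc j + i) = {j<..}"
    by (simp_all add: bij_betw_def)
  with * show ?thesis using has_sum_reindex[of "\<lambda>i. Suc j + i" UNIV "\<lambda>i. (1/2::real) ^ i"]
    by simp
qed

lemma binary_expansion_agree:
  assumes B: "is_binary_expansion x B" and C: "is_binary_expansion x C"
    and j: "j \<in> B" "j \<notin> C" and agree: "\<And>k. k < j \<Longrightarrow> k \<in> B \<longleftrightarrow> k \<in> C"
  shows False
proof -
  let ?f = "\<lambda>i::nat. (1/2::real) ^ i"
  define A where "A = B \<inter> {..<j}"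
  have A: "finite A" "j \<notin> A" "A = C \<inter> {..<j}" using agree by (auto simp: A_def)
  have xB: "(?f has_sum x) B" and xC: "(?f has_sum x) C" and fin: "x \<in> dyadics \<Longrightarrow> finite C"
    using B C by (auto simp: is_binary_expansion_def)
  have "sum ?f (insert j A) \<le> x"
    by (rule has_sum_mono2[OF has_sum_finite xB]) (use A j in \<open>auto simp: A_def\<close>)
  then have lower: "sum ?f A + ?f j \<le> x" using A by simp
  have tail: "(?f has_sum (sum ?f A + ?f j)) (A \<union> {j<..})"
    by (rule has_sum_Un_disjoint[OF has_sum_finite has_sum_half_tail]) (use A in auto)
  have sub: "C \<subseteq> A \<union> {j<..}"
  proof
    fix k assume "k \<in> C"
    then show "k \<in> A \<union> {j<..}" using A(3) j by (cases k j rule: linorder_cases) auto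
  qed
  have upper: "x \<le> sum ?f A + ?f j" by (rule has_sum_mono2[OF xC tail sub]) auto
  have x: "x = sum ?f A + ?f j" using lower upper by simp
  have "x = real ((\<Sum>i\<in>A. 2 ^ (j - i)) + 1) / 2 ^ j"
  proof -
    have "?f i = 2 ^ (j - i) / 2 ^ j" if "i \<in> A" for i
    proof -
      have "(2::real) ^ j = 2 ^ (j - i) * 2 ^ i" using that A(3) by (simp flip: power_add)
      then show ?thesis by (simp add: power_one_over)
    qed
    then have "sum ?f A = (\<Sum>i\<in>A. 2 ^ (j - i) / 2 ^ j)" by (rule sum.cong[OF refl])
    then show ?thesis unfolding x by (simp add: add_divide_distrib sum_divide_distrib power_one_over)
  qed
  then have "x \<in> dyadics" unfolding dyadics_def by blast
  then have "finite C" by (rule fin)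
  then have "\<exists>k\<in>{j<..}. k \<notin> C"
    using infinite_Ioi[of j] finite_subset[of "{j<..}" C] by blast
  then obtain k where k: "k > j" "k \<notin> C" by auto
  have "(?f has_sum (x + ?f k)) (C \<union> {k})"
    by (rule has_sum_Un_disjoint[OF xC]) (use k in \<open>auto intro!: has_sum_finiteI\<close>)
  then have "x + ?f k \<le> sum ?f A + ?f j"
    by (rule has_sum_mono2[OF _ tail]) (use sub k in auto)
  then have "?f k \<le> 0" unfolding x by linarith
  moreover have "?f k > 0" by simp
  ultimately show False by linarith
qed

lemma binary_expansion_unique:
  assumes "is_binary_expansion x B" "is_binary_expansion x C"
  shows "B = C"
proof (rule ccontr)
  assume "B \<noteq> C"
  then have ex: "\<exists>j. (j \<in> B) \<noteq> (j \<in> C)" by auto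
  define j where "j = (LEAST j. (j \<in> B) \<noteq> (j \<in> C))"
  have j: "(j \<in> B) \<noteq> (j \<in> C)" unfolding j_def by (rule LeastI_ex[OF ex])
  have k: "k \<in> B \<longleftrightarrow> k \<in> C" if "k < j" for k
    using not_less_Least[of k "\<lambda>j. (j \<in> B) \<noteq> (j \<in> C)"] that unfolding j_def by blast
  show False
    using j binary_expansion_agree[OF assms, of j] binary_expansion_agree[OF assms(2,1), of j] k
    by blast
qed

lemma is_binary_expansion_floor:
  assumes x: "0 \<le> x" "x < 1"
  shows "is_binary_expansion x {i\<in>{1..}. odd \<lfloor>2 ^ i * x\<rfloor>}" (is "is_binary_expansion x ?B")
proof -
  let ?f = "\<lambda>i::nat. (1/2::real) ^ i"
  have step: "\<lfloor>2 ^ Suc n * x\<rfloor> = 2 * \<lfloor>2 ^ n * x\<rfloor> + (if odd \<lfloor>2 ^ Suc n * x\<rfloor> then 1 else 0)" for n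
  proof -
    have "\<lfloor>2 * y\<rfloor> = 2 * \<lfloor>y\<rfloor> \<or> \<lfloor>2 * y\<rfloor> = 2 * \<lfloor>y\<rfloor> + 1" for y :: real by linarith
    from this[of "2 ^ n * x"] show ?thesis by (auto simp: mult.assoc)
  qed
  have S: "(\<Sum>i\<le>n. if i \<in> ?B then ?f i else 0) = of_int \<lfloor>2 ^ n * x\<rfloor> / 2 ^ n" for n
  proof (induction n)
    case 0
    have "\<lfloor>x\<rfloor> = 0" using x by linarith
    then show ?case by simp
  next
    case (Suc n)
    have "real_of_int \<lfloor>2 ^ Suc n * x\<rfloor> / 2 ^ Suc n =
        of_int \<lfloor>2 ^ n * x\<rfloor> / 2 ^ n + (if odd \<lfloor>2 ^ Suc n * x\<rfloor> then ?f (Suc n) else 0)"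
      by (subst step) (auto simp: add_divide_distrib power_one_over)
    then show ?case using Suc.IH by (simp add: sum.atMost_Suc)
  qed
  have "(\<lambda>n. of_int \<lfloor>2 ^ n * x\<rfloor> / 2 ^ n) \<longlonglongrightarrow> x"
  proof (rule tendsto_sandwich)
    show "\<forall>\<^sub>F n in sequentially. x - ?f n \<le> of_int \<lfloor>2 ^ n * x\<rfloor> / 2 ^ n"
    proof (intro always_eventually allI)
      fix n
      have "(2 ^ n * x - 1) / 2 ^ n \<le> of_int \<lfloor>2 ^ n * x\<rfloor> / 2 ^ n"
        by (intro divide_right_mono) (linarith, simp)
      then show "x - ?f n \<le> of_int \<lfloor>2 ^ n * x\<rfloor> / 2 ^ n"
        by (simp add: diff_divide_distrib power_one_over)
    qed
    show "\<forall>\<^sub>F n in sequentially. of_int \<lfloor>2 ^ n * x\<rfloor> / 2 ^ n \<le> x"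
      by (intro always_eventually allI) (simp add: divide_le_eq mult.commute)
    have "?f \<longlonglongrightarrow> 0" by (rule LIMSEQ_power_zero) simp
    from tendsto_diff[OF tendsto_const[of x] this] show "(\<lambda>n. x - ?f n) \<longlonglongrightarrow> x" by simp
  qed simp
  then have "(\<lambda>i. if i \<in> ?B then ?f i else 0) sums x" unfolding sums_def_le S .
  then have "((\<lambda>i. if i \<in> ?B then ?f i else 0) has_sum x) UNIV"
    by (rule sums_nonneg_imp_has_sum) simp
  also have "?this \<longleftrightarrow> (?f has_sum x) ?B" by (rule has_sum_cong_neutral) auto
  finally have "(?f has_sum x) ?B" .
  moreover have "finite ?B" if "x \<in> dyadics"
  proof -
    from that obtain m k where m: "x = of_nat m / 2 ^ k" unfolding dyadics_def by blast
    have "?B \<subseteq> {..k}"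
    proof
      fix i assume i: "i \<in> ?B"
      show "i \<in> {..k}"
      proof (rule ccontr)
        assume "i \<notin> {..k}"
        then obtain d where d: "i = k + Suc d" using less_imp_Suc_add[of k i] by auto
        have "2 ^ i * x = of_int (2 * (2 ^ d * int m))" unfolding m d by (simp add: power_add)
        then have "\<lfloor>2 ^ i * x\<rfloor> = 2 * (2 ^ d * int m)" by (simp only: floor_of_int)
        then show False using i by simp
      qed
    qed
    then show ?thesis by (rule finite_subset) simp
  qed
  ultimately show ?thesis unfolding is_binary_expansion_def by auto
qed

lemma ex1_is_binary_expansion:
  assumes "0 < x" "x < 1"
  shows "\<exists>!B. is_binary_expansion x B"
  using is_binary_expansion_floor[of x] binary_expansion_unique assms by (meson less_imp_le)

lemma is_binary_expansion_binary_positions: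
  assumes "0 < x" "x < 1"
  shows "is_binary_expansion x (binary_positions x)"
  unfolding binary_positions_def by (rule theI'[OF ex1_is_binary_expansion[OF assms]])

end

theory Submission
  imports Defs
begin

text \<open>Conditioning a lexicographic family on its first coordinate gives another lexicographic
  family, so the sum of its first \<open>k\<close> influences is a function \<open>\<Phi>\<^sub>k\<close> of its measure alone, where
  \<open>\<Phi>\<^sub>0 = 0\<close>, \<open>\<Phi>\<^sub>k\<^sub>+\<^sub>1 (p t) = p \<Phi>\<^sub>k t + t\<close> and \<open>\<Phi>\<^sub>k\<^sub>+\<^sub>1 (p + q t) = q \<Phi>\<^sub>k t + 1 - t\<close> with \<open>q = 1 - p\<close>.
  Splitting a monotone family along its last coordinate reduces the theorem to the two-point inequality
  \<open>\<Phi>\<^sub>k (p a + q b) \<le> p \<Phi>\<^sub>k a + q \<Phi>\<^sub>k b + (a - b)\<close> for \<open>b \<le> a\<close>. The recursion reproduces this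
  inequality, scaled by \<open>p\<close> or \<open>q\<close>, when \<open>a\<close> and \<open>b\<close> lie on the same side of \<open>p\<close>; when they lie on
  different sides it turns into \<open>\<Phi>\<^sub>k s \<le> \<Phi>\<^sub>k a + \<Phi>\<^sub>k b\<close> with \<open>s\<close> equal to \<open>a + b\<close> or \<open>a + b - 1\<close>.\<close>

section \<open>The profile of the lexicographic families\<close>

text \<open>A lexicographic family of measure \<open>x \<le> p\<close> contains only sets with the
  first coordinate, so its two sections have measures \<open>x / p\<close> and 0. Otherwise it
  contains all of those sets, and the sections have measures 1 and \<open>(x - p) / (1 - p)\<close>.
  The term without \<open>H\<close> is the difference of the section measures, the first influence;
  the term with \<open>H\<close> is the contribution of the later coordinates.\<close>

definition lex_step :: "real \<Rightarrow> (real \<Rightarrow> real) \<Rightarrow> real \<Rightarrow> real" where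
  "lex_step p H x =
     (if x \<le> p then p * H (x / p) + x / p
      else (1 - p) * H ((x - p) / (1 - p)) + 1 - (x - p) / (1 - p))"

primrec lex_profile :: "real \<Rightarrow> nat \<Rightarrow> real \<Rightarrow> real" where
  "lex_profile p 0 = (\<lambda>_. 0)"
| "lex_profile p (Suc k) = lex_step p (lex_profile p k)"

lemma lex_step_low:
  assumes "0 < p" "t \<le> 1"
  shows "lex_step p H (p * t) = p * H t + t"
  using assms by (simp add: lex_step_def mult_le_cancel_left1)

text \<open>At \<open>t = 0\<close> the definition takes the low branch, with value
  \<open>p * H 1 + 1\<close>. The two formulas agree there because \<open>H\<close> vanishes at both
  ends.\<close>

lemma lex_step_high:
  assumes "0 < p" "0 < q" "p + q = 1" "0 \<le> t" "H 0 = 0" "H 1 = 0"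
  shows "lex_step p H (p + q * t) = q * H t + 1 - t"
proof (cases "t = 0")
  case True
  then show ?thesis using assms by (simp add: lex_step_def)
next
  case False
  then have "\<not> p + q * t \<le> p" using assms by (simp add: not_le)
  moreover have "1 - p = q" using assms by simp
  ultimately show ?thesis using assms(2) by (simp add: lex_step_def)
qed

lemma unit_interval_split:
  fixes p q x :: real
  assumes "0 < p" "0 < q" "p + q = 1" "0 \<le> x" "x \<le> 1"
  obtains (low) t where "0 \<le> t" "t \<le> 1" "x = p * t" "x \<le> p"
    | (high) t where "0 \<le> t" "t \<le> 1" "x = p + q * t" "p \<le> x"
proof (cases "x \<le> p")
  case True
  show ?thesis by (rule low[of "x / p"]) (use assms True in auto)
next
  case False
  show ?thesis by (rule high[of "(x - p) / q"]) (use assms False in \<open>auto simp: divide_le_eq\<close>)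
qed

lemma lex_profile_0: "0 < p \<Longrightarrow> p < 1 \<Longrightarrow> lex_profile p k 0 = 0"
  by (induction k) (auto simp: lex_step_def)

lemma lex_profile_1: "0 < p \<Longrightarrow> p < 1 \<Longrightarrow> lex_profile p k 1 = 0"
  by (induction k) (auto simp: lex_step_def)

lemma lex_step_mono:
  assumes "0 < p" "p < 1" "\<And>x. x \<in> {0..1} \<Longrightarrow> H x \<le> K x" "x \<in> {0..1}"
  shows "lex_step p H x \<le> lex_step p K x"
  using assms by (auto simp: lex_step_def divide_le_eq)

lemma lex_profile_nonneg:
  assumes "0 < p" "p < 1" "x \<in> {0..1}"
  shows "0 \<le> lex_profile p k x"
  using assms(3)
proof (induction k arbitrary: x)
  case (Suc k)
  then show ?case using assms(1,2)
    by (auto simp: lex_step_def divide_le_eq intro!: add_nonneg_nonneg add_nonneg_pos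
        simp flip: add_diff_eq)
qed simp

text \<open>The first step up from 0 is nonnegativity, and monotonicity of \<open>lex_step\<close>
  propagates it. In the two-point inequality this buys one extra unfolding of the recursion.\<close>

lemma lex_profile_increasing:
  assumes "0 < p" "p < 1" "x \<in> {0..1}"
  shows "lex_profile p k x \<le> lex_step p (lex_profile p k) x"
  using assms(3)
proof (induction k arbitrary: x)
  case 0
  then show ?case using lex_profile_nonneg[OF assms(1,2), of x 1] by simp
next
  case (Suc k)
  then show ?case unfolding lex_profile.simps by (intro lex_step_mono assms(1,2)) auto
qed

text \<open>Passing to dual families \<open>{S. - S \<notin> F}\<close> exchanges \<open>p\<close> with \<open>1 - p\<close> and the measure \<open>x\<close>
  with \<open>1 - x\<close>.\<close>
lemma lex_profile_dual:
  assumes "0 < p" "p < 1" "x \<in> {0..1}"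
  shows "lex_profile (1 - p) k x = lex_profile p k (1 - x)"
  using assms(3)
proof (induction k arbitrary: x)
  case (Suc k)
  let ?q = "1 - p"
  let ?H = "lex_profile p k" and ?K = "lex_profile ?q k"
  have q: "0 < ?q" "?q < 1" "?q + p = 1" "p + ?q = 1" using assms by auto
  have x: "0 \<le> x" "x \<le> 1" using Suc.prems by auto
  note ends = lex_profile_0 lex_profile_1
  show ?case
  proof (cases rule: unit_interval_split[OF q(1) assms(1) q(3) x])
    case (1 t)
    have "lex_step ?q ?K x = ?q * ?K t + t" unfolding 1(3) by (intro lex_step_low q 1)
    moreover have "1 - x = p + ?q * (1 - t)" unfolding 1(3) by (simp add: algebra_simps)
    moreover have "lex_step p ?H (p + ?q * (1 - t)) = ?q * ?H (1 - t) + 1 - (1 - t)"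
      by (intro lex_step_high q assms ends) (use 1 in auto)
    ultimately show ?thesis using Suc.IH[of t] 1 by simp
  next
    case (2 t)
    have "lex_step ?q ?K x = p * ?K t + 1 - t"
      unfolding 2(3) by (intro lex_step_high q 2 ends assms)
    moreover have "1 - x = p * (1 - t)" unfolding 2(3) by (simp add: algebra_simps)
    moreover have "lex_step p ?H (p * (1 - t)) = p * ?H (1 - t) + (1 - t)"
      by (intro lex_step_low assms) (use 2 in auto)
    ultimately show ?thesis using Suc.IH[of t] 2 by simp
  qed
qed simp

section \<open>Subadditivity of the profile\<close>

text \<open>The two scaling conditions are what is left of subadditivity when the sum \<open>a + b\<close> crosses the
  breakpoint \<open>p\<close>; unlike subadditivity of \<open>H\<close> alone, all conditions together are preserved by
  \<^const>\<open>lex_step\<close>. The constants stand for \<open>c = p / q\<close> and \<open>d = q / p\<close>.\<close>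
locale subadditive_profile =
  fixes p q c d :: real and H :: "real \<Rightarrow> real"
  assumes pq: "0 < p" "p \<le> q" "p + q = 1"
    and cq: "c * q = p" and dp: "d * p = q"
    and H_0: "H 0 = 0" and H_1: "H 1 = 0"
    and nonneg: "\<And>x. 0 \<le> x \<Longrightarrow> x \<le> 1 \<Longrightarrow> 0 \<le> H x"
    and bounded: "\<And>x. 0 \<le> x \<Longrightarrow> x \<le> 1 \<Longrightarrow> p * H x \<le> 1"
    and subadd: "\<And>a b. 0 \<le> a \<Longrightarrow> 0 \<le> b \<Longrightarrow> a + b \<le> 1 \<Longrightarrow> H (a + b) \<le> H a + H b"
    and subadd_wrap: "\<And>a b. a \<le> 1 \<Longrightarrow> b \<le> 1 \<Longrightarrow> 1 \<le> a + b \<Longrightarrow> H (a + b - 1) \<le> H a + H b"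
    and scaling: "\<And>t. 0 \<le> t \<Longrightarrow> t \<le> 1 \<Longrightarrow> q * H (c * t) \<le> p * H t + (1 + c) * t"
    and scaling_dual:
      "\<And>r. 0 \<le> r \<Longrightarrow> d * r \<le> 1 \<Longrightarrow> p * H (1 - d * r) \<le> q * H (1 - r) + (1 + d) * r"
begin

lemma q_pos: "0 < q" using pq by linarith

lemma c_pos: "0 < c"
proof -
  have "0 < c * q" using pq(1) unfolding cq .
  then show ?thesis using q_pos by (rule zero_less_mult_pos2)
qed

lemma c_le: "c \<le> 1"
proof (rule ccontr)
  assume "\<not> c \<le> 1"
  then have "1 * q < c * q" using q_pos by (intro mult_strict_right_mono) auto
  then show False using pq cq by linarith
qed

lemma d_ge: "1 \<le> d"
proof (rule ccontr)
  assume "\<not> 1 \<le> d"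
  then have "d * p < 1 * p" using pq by (intro mult_strict_right_mono) auto
  then show False using pq dp by linarith
qed

lemma cd: "c * d = 1"
proof -
  have "(c * d) * p = c * q" using dp by simp
  also have "\<dots> = 1 * p" using cq by simp
  finally show ?thesis using pq(1) by simp
qed

lemma q_inv: "q * (1 + c) = 1"
proof -
  have "q * (1 + c) = q + c * q" by (simp add: algebra_simps)
  then show ?thesis using pq(3) cq by linarith
qed

lemma p_inv: "p * (1 + d) = 1"
proof -
  have "p * (1 + d) = p + d * p" by (simp add: algebra_simps)
  then show ?thesis using pq(3) dp by linarith
qed

abbreviation "TH \<equiv> lex_step p H"

lemma TH_low: "t \<le> 1 \<Longrightarrow> TH (p * t) = p * H t + t"
  using pq by (intro lex_step_low) auto

lemma TH_high: "0 \<le> t \<Longrightarrow> TH (p + q * t) = q * H t + 1 - t"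
  using pq q_pos H_0 H_1 by (intro lex_step_high) auto

lemma split:
  assumes "0 \<le> x" "x \<le> 1"
  obtains (low) t where "0 \<le> t" "t \<le> 1" "x = p * t" "x \<le> p"
    | (high) t where "0 \<le> t" "t \<le> 1" "x = p + q * t" "p \<le> x"
  using unit_interval_split[OF pq(1) q_pos pq(3) assms] by metis

lemma scaling_1: "q * H c \<le> 1 + c"
  using scaling[of 1] H_1 by simp

lemma ct_bounds: "0 \<le> t \<Longrightarrow> t \<le> 1 \<Longrightarrow> 0 \<le> c * t \<and> c * t \<le> 1"
  using c_pos c_le by (simp add: mult_le_one)

lemma q_mono: "x \<le> y \<Longrightarrow> q * x \<le> q * y"
  using q_pos by simp

lemma p_mono: "x \<le> y \<Longrightarrow> p * x \<le> p * y"
  using pq by simp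

section \<open>Preservation of the conditions under one step of the recursion\<close>

text \<open>The low branch is bounded by \<open>p + p\<close>, which is at most 1 since
  \<open>p \<le> q\<close>, and the high branch by \<open>q + p\<close>. The bound settles the case
  \<open>p < r\<close> of the dual scaling condition.\<close>

lemma step_bounded:
  assumes x: "0 \<le> x" "x \<le> 1"
  shows "p * TH x \<le> 1"
  using x
proof (cases rule: split)
  case (low t)
  have "p * TH x = p * (p * H t) + p * t" using low by (simp add: TH_low) (simp add: algebra_simps)
  also have "\<dots> \<le> p * 1 + p * 1" using low by (intro add_mono p_mono bounded)
  finally show ?thesis using pq by linarith
next
  case (high t)
  have "p * TH x = q * (p * H t) + p * (1 - t)" using high by (simp add: TH_high) (simp add: algebra_simps)
  also have "\<dots> \<le> q * 1 + p * 1" using high by (intro add_mono p_mono q_mono bounded) auto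
  finally show ?thesis using pq by linarith
qed

lemma step_nonneg:
  assumes x: "0 \<le> x" "x \<le> 1"
  shows "0 \<le> TH x"
  using x
proof (cases rule: split)
  case (low t)
  then show ?thesis using pq nonneg[of t] by (simp add: TH_low)
next
  case (high t)
  then have "0 \<le> q * H t" using q_pos nonneg[of t] by simp
  then show ?thesis using high by (simp add: TH_high)
qed

text \<open>Since \<open>p = q * c\<close>, adding the low point \<open>p * b\<close> moves the
  coordinate of the high point from \<open>a\<close> to \<open>a + c * b\<close>. Subadditivity of
  \<open>H\<close> separates the two terms, and \<open>scaling\<close> trades
  \<open>q * H (c * b)\<close> for \<open>p * H b\<close>.\<close>

lemma step_subadd_low_high:
  assumes a: "0 \<le> a" "a \<le> 1" and b: "0 \<le> b" "b \<le> 1" and s: "p + q * a + p * b \<le> 1"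
  shows "TH (p + q * a + p * b) \<le> TH (p + q * a) + TH (p * b)"
proof -
  have e: "p + q * a + p * b = p + q * (a + c * b)" using cq by (simp add: algebra_simps)
  have "q * (a + c * b) \<le> q * 1" using s pq unfolding e by linarith
  then have s': "a + c * b \<le> 1" using q_pos by simp
  have cb: "0 \<le> c * b" using ct_bounds b by simp
  have "q * H (a + c * b) \<le> q * H a + q * H (c * b)"
    using q_mono[OF subadd[OF a(1) cb s']] by (simp add: algebra_simps)
  moreover have "q * H (c * b) \<le> p * H b + b + c * b" using scaling[OF b] by (simp add: algebra_simps)
  ultimately show ?thesis using a b cb unfolding e by (simp add: TH_high TH_low)
qed

lemma step_subadd:
  assumes x: "0 \<le> x" and y: "0 \<le> y" and xy: "x + y \<le> 1"
  shows "TH (x + y) \<le> TH x + TH y"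
proof -
  have x1: "x \<le> 1" and y1: "y \<le> 1" using assms by auto
  from x x1 show ?thesis
  proof (cases rule: split)
    case l: (low a)
    from y y1 show ?thesis
    proof (cases rule: split)
      case l': (low b)
      have e: "x + y = p * (a + b)" using l l' by (simp add: algebra_simps)
      show ?thesis
      proof (cases "a + b \<le> 1")
        case True
        have "p * H (a + b) \<le> p * (H a + H b)" using True l l' by (intro p_mono subadd)
        then show ?thesis using True l l' unfolding e by (simp add: TH_low) (simp add: algebra_simps)
      next
        case False
        let ?u = "a + b - 1"
        have u: "0 \<le> ?u" "?u \<le> 1" using False l l' by auto
        \<comment> \<open>Two low points overshoot the breakpoint by \<open>p * ?u\<close>, which is
          \<open>q * (c * ?u)\<close> in the high coordinate; \<open>scaling\<close> at
          \<open>?u\<close> then leads back to the wrapped sum.\<close>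
        have e': "x + y = p + q * (c * ?u)" unfolding e using pq(3) cq
          by (simp add: algebra_simps)
        have "TH (x + y) = q * H (c * ?u) + 1 - c * ?u"
          unfolding e' using ct_bounds[OF u] by (simp add: TH_high)
        moreover have "p * H ?u \<le> p * (H a + H b)" using l l' False by (intro p_mono subadd_wrap) auto
        moreover note scaling[OF u]
        ultimately show ?thesis using l l' by (simp add: TH_low) (simp add: algebra_simps)
      qed
    next
      case (high b)
      show ?thesis using step_subadd_low_high[of b a] high l xy
        by (simp add: algebra_simps)
    qed
  next
    case h: (high a)
    from y y1 show ?thesis
    proof (cases rule: split)
      case (low b)
      show ?thesis using step_subadd_low_high[of a b] h low xy by (simp add: algebra_simps)
    next
      case h': (high b)
      \<comment> \<open>The second copy of the breakpoint contributes \<open>p = q * c\<close>; its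
        cost \<open>q * H c\<close> is at most \<open>1 + c\<close>, by scaling at 1.\<close>
      have e: "x + y = p + q * (a + b + c)" using cq h h' by (simp add: algebra_simps)
      have "q * (a + b + c) \<le> q * 1" using xy pq unfolding e by linarith
      then have s: "a + b + c \<le> 1" using q_pos by simp
      have "H (a + b + c) \<le> H (a + b) + H c" using s h h' c_pos by (intro subadd) auto
      moreover have "H (a + b) \<le> H a + H b" using s h h' c_pos by (intro subadd) auto
      ultimately have "q * H (a + b + c) \<le> q * (H a + H b + H c)" by (intro q_mono) auto
      then show ?thesis using scaling_1 h h' c_pos unfolding e by (simp add: TH_high) (simp add: algebra_simps)
    qed
  qed
qed

text \<open>The high point lies \<open>q * ?r = p * (d * ?r)\<close> below 1, so the result is low,
  with coordinate the wrapped sum of \<open>a\<close> and \<open>1 - d * ?r\<close>. The dual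
  scaling condition then removes the factor \<open>d\<close>.\<close>

lemma step_subadd_wrap_low_high:
  assumes a: "0 \<le> a" "a \<le> 1" and b: "0 \<le> b" "b \<le> 1" and s: "1 \<le> p * a + (p + q * b)"
  shows "TH (p * a + (p + q * b) - 1) \<le> TH (p * a) + TH (p + q * b)"
proof -
  let ?r = "1 - b"
  have e: "p * a + (p + q * b) - 1 = p * (a + (1 - d * ?r) - 1)"
    using pq(3) dp by (simp add: algebra_simps)
  then have "0 \<le> p * (a + (1 - d * ?r) - 1)" using s by linarith
  then have s': "1 \<le> a + (1 - d * ?r)" using pq by (simp add: zero_le_mult_iff)
  have dr: "0 \<le> d * ?r" "d * ?r \<le> 1" using s' a b d_ge by auto
  have "p * H (a + (1 - d * ?r) - 1) \<le> p * (H a + H (1 - d * ?r))"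
    using s' dr a by (intro p_mono subadd_wrap) auto
  moreover have "p * H (1 - d * ?r) \<le> q * H (1 - ?r) + (1 + d) * ?r"
    using b dr by (intro scaling_dual) auto
  ultimately show ?thesis using a b dr unfolding e
    by (simp add: TH_low TH_high) (simp add: algebra_simps)
qed

lemma step_subadd_wrap:
  assumes x1: "x \<le> 1" and y1: "y \<le> 1" and xy: "1 \<le> x + y"
  shows "TH (x + y - 1) \<le> TH x + TH y"
proof -
  have x: "0 \<le> x" and y: "0 \<le> y" using assms by auto
  from x x1 show ?thesis
  proof (cases rule: split)
    case l: (low a)
    from y y1 show ?thesis
    proof (cases rule: split)
      case l': (low b)
      \<comment> \<open>Two low points add up to at most \<open>2 * p \<le> 1\<close>, so the
        wrapped sum can only be 0.\<close>
      have "x + y - 1 = p * 0" using xy l(4) l'(4) pq(2,3) by simp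
      then have "TH (x + y - 1) = 0" using TH_low[of 0] H_0 by simp
      then show ?thesis using step_nonneg x x1 y y1 by simp
    next
      case (high b)
      show ?thesis using step_subadd_wrap_low_high[of a b] high l xy by simp
    qed
  next
    case h: (high a)
    from y y1 show ?thesis
    proof (cases rule: split)
      case (low b)
      show ?thesis using step_subadd_wrap_low_high[of b a] h low xy by (simp add: algebra_simps)
    next
      case h': (high b)
      have e: "x + y - 1 = p + q * (a + b - 1)" using pq(3) h h' by (simp add: algebra_simps)
      show ?thesis
      proof (cases "1 \<le> a + b")
        case True
        have "q * H (a + b - 1) \<le> q * (H a + H b)" using True h h' by (intro q_mono subadd_wrap) auto
        then show ?thesis using True h h' unfolding e by (simp add: TH_high) (simp add: algebra_simps)
      next
        case False
        let ?r = "1 - (a + b)"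
        \<comment> \<open>The result falls below the breakpoint by
          \<open>q * ?r = p * (d * ?r)\<close>, which gives its low coordinate.\<close>
        have e': "x + y - 1 = p * (1 - d * ?r)" unfolding e using dp by (simp add: algebra_simps)
        then have "0 \<le> p * (1 - d * ?r)" using xy by linarith
        then have dr: "d * ?r \<le> 1" using pq by (simp add: zero_le_mult_iff)
        have dr0: "0 \<le> d * ?r" using d_ge False by simp
        have "p * H (1 - d * ?r) \<le> q * H (1 - ?r) + (1 + d) * ?r"
          using dr False by (intro scaling_dual) auto
        moreover have "q * H (a + b) \<le> q * (H a + H b)" using False h h' by (intro q_mono subadd) auto
        ultimately show ?thesis using h h' dr0 unfolding e'
          by (simp add: TH_low TH_high) (simp add: algebra_simps)
      qed
    qed
  qed
qed

text \<open>A low \<open>t\<close> reproduces the condition with factor \<open>p\<close>. A high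
  \<open>t = p + q * s\<close> gives \<open>c * t = p * (c + s)\<close>, so subadditivity or its
  wrapped form separates \<open>H s\<close> from \<open>H c\<close>, and
  \<open>q * H c \<le> 1 + c\<close> absorbs the latter.\<close>

lemma step_scaling:
  assumes t: "0 \<le> t" "t \<le> 1"
  shows "q * TH (c * t) \<le> p * TH t + (1 + c) * t"
  using t
proof (cases rule: split)
  case (low s)
  have e: "c * t = p * (c * s)" using low by simp
  have "q * TH (c * t) = p * (q * H (c * s)) + q * c * s"
    unfolding e using ct_bounds[of s] low(1,2) by (simp add: TH_low) (simp add: algebra_simps)
  also have "\<dots> \<le> p * (p * H s + (1 + c) * s) + p * s"
    using low scaling[of s] cq by (intro add_mono p_mono) (auto simp: algebra_simps)
  also have "\<dots> = p * TH t + (1 + c) * t" using low by (simp add: TH_low) (simp add: algebra_simps)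
  finally show ?thesis .
next
  case (high s)
  have Tt: "TH t = q * H s + 1 - s" using high by (simp add: TH_high)
  have pqc: "p * (q * H c) \<le> p * (1 + c)" by (intro p_mono scaling_1)
  have pc: "p * c + p = c" 
  proof -
    have "c = c * (q * (1 + c))" unfolding q_inv by simp
    also have "\<dots> = (c * q) * c + c * q" by (simp add: algebra_simps)
    finally show ?thesis unfolding cq by simp
  qed
  have e: "c * t = p * (c + s)" using high pc cq by (simp add: algebra_simps)
  have t2: "(1 + c) * t = c + s"
  proof -
    have "(1 + c) * t = (1 + c) * p + (q * (1 + c)) * s" using high by (simp add: algebra_simps)
    then show ?thesis using pc unfolding q_inv by (simp add: algebra_simps)
  qed
  show ?thesis
  proof (cases "c + s \<le> 1")
    case True
    have "p * (q * H (s + c)) \<le> p * (q * (H s + H c))"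
      using True c_pos high by (intro p_mono q_mono subadd) auto
    moreover have "q * TH (c * t) = p * (q * H (s + c)) + q * (c + s)"
      unfolding e using True by (simp add: TH_low) (simp add: algebra_simps)
    moreover have "q * c = p" "q * s + p * s = s"
      using pq(3) cq by (simp_all add: mult.commute add.commute flip: distrib_right)
    ultimately show ?thesis using pqc pc unfolding t2 Tt by (simp add: algebra_simps)
  next
    case False
    let ?u = "s + c - 1"
    have u: "0 \<le> ?u" "?u \<le> 1" using False high c_le by auto
    have e': "c * t = p + q * (c * ?u)" unfolding e using pq(3) cq by (simp add: algebra_simps)
    have "q * TH (c * t) = q * (q * H (c * ?u)) + q - (q * c) * ?u"
      unfolding e' using ct_bounds[OF u] by (simp add: TH_high) (simp add: algebra_simps)
    also have "\<dots> \<le> q * (p * H ?u + (1 + c) * ?u) + q - (q * c) * ?u"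
      using q_mono[OF scaling[OF u]] by simp
    also have "\<dots> = p * (q * H ?u) + (q * (1 + c)) * ?u + q - (q * c) * ?u"
      by (simp add: algebra_simps)
    also have "\<dots> = p * (q * H ?u) + q * ?u + q"
    proof -
      have qc: "q * c = 1 - q" using cq pq(3) by (simp add: mult.commute)
      show ?thesis unfolding q_inv qc by (simp add: algebra_simps)
    qed
    also have "\<dots> \<le> p * (q * (H s + H c)) + q * ?u + q"
      using u c_le False high by (intro add_right_mono p_mono q_mono subadd_wrap) auto
    also have "\<dots> \<le> p * (q * H s) + p * (1 + c) + q * ?u + q"
      using pqc by (simp add: algebra_simps)
    also have "\<dots> = p * (q * H s) + c + q * s + p"
      using pc cq by (simp add: algebra_simps)
    also have "\<dots> = p * TH t + (c + s)"
    proof -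
      have "q * s + p * s = s" using pq(3) by (simp flip: distrib_right add: add.commute)
      then show ?thesis unfolding Tt by (simp add: algebra_simps)
    qed
    finally show ?thesis unfolding t2 .
  qed
qed

text \<open>For \<open>r \<le> p\<close> both arguments are high, and the condition for
  \<open>H\<close> at \<open>s = r / q\<close>, written \<open>(1 + c) * r\<close>, is reproduced
  with factor \<open>q\<close>. For \<open>r > p\<close> the left side is at most 1 by
  \<open>step_bounded\<close>, while \<open>(1 + d) * r\<close> is at least
  \<open>(1 + d) * p = 1\<close>.\<close>

lemma step_scaling_dual:
  assumes r: "0 \<le> r" "d * r \<le> 1"
  shows "p * TH (1 - d * r) \<le> q * TH (1 - r) + (1 + d) * r"
proof -
  have "1 * r \<le> d * r" using r d_ge by (intro mult_right_mono) auto
  then have r1: "r \<le> 1" using r by simp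
  have dr: "0 \<le> d * r" using d_ge r by simp
  show ?thesis
  proof (cases "r \<le> p")
    case True
    define s where "s = (1 + c) * r"
    have rs: "r = q * s" using q_inv unfolding s_def by (simp flip: mult.assoc)
    have s: "0 \<le> s" using c_pos r unfolding s_def by simp
    have "d * s = (1 + d) * r" using cd unfolding s_def by (simp add: algebra_simps)
    moreover have "p * ((1 + d) * r) = r" using p_inv by (simp flip: mult.assoc)
    ultimately have pds: "p * (d * s) = r" by simp
    then have "p * (d * s) \<le> p * 1" using True by simp
    then have ds: "d * s \<le> 1" using pq by simp
    have "1 * s \<le> d * s" using s d_ge by (intro mult_right_mono) auto
    then have s1: "s \<le> 1" using ds by simp
    have "1 - r = p + q * (1 - s)" using pq(3) unfolding rs by (simp add: algebra_simps)
    then have T1: "TH (1 - r) = q * H (1 - s) + s" using s1 TH_high[of "1 - s"] by simp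
    have "1 - d * r = p + q * (1 - d * s)" using pq(3) unfolding rs by (simp add: algebra_simps)
    then have T2: "TH (1 - d * r) = q * H (1 - d * s) + d * s" using ds TH_high[of "1 - d * s"] by simp
    have "p * TH (1 - d * r) = q * (p * H (1 - d * s)) + p * (d * s)"
      unfolding T2 by (simp add: algebra_simps)
    also have "\<dots> \<le> q * (q * H (1 - s) + (1 + d) * s) + r"
      unfolding pds using q_mono[OF scaling_dual[OF s ds]] by simp
    also have "\<dots> = q * TH (1 - r) + (1 + d) * r"
      unfolding T1 using rs by (simp add: algebra_simps)
    finally show ?thesis .
  next
    case False
    have "p * TH (1 - d * r) \<le> 1" using r dr by (intro step_bounded) auto
    also have "1 \<le> (1 + d) * r"
    proof -
      have "(1 + d) * p \<le> (1 + d) * r" using False d_ge by (intro mult_left_mono) auto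
      then show ?thesis using p_inv by (simp add: mult.commute)
    qed
    also have "\<dots> \<le> q * TH (1 - r) + (1 + d) * r" using step_nonneg[of "1 - r"] r r1 q_pos by simp
    finally show ?thesis .
  qed
qed

lemma step: "subadditive_profile p q c d TH"
proof
  show "TH 0 = 0" using TH_low[of 0] H_0 by simp
  show "TH 1 = 0" using TH_high[of 1] H_1 pq by simp
qed (fact pq cq dp step_nonneg step_bounded step_subadd step_subadd_wrap step_scaling step_scaling_dual)+

end

section \<open>Subadditivity for every bias\<close>

lemma lex_profile_subadditive_half:
  assumes "0 < p" "p \<le> 1 / 2"
  shows "subadditive_profile p (1 - p) (p / (1 - p)) ((1 - p) / p) (lex_profile p k)"
proof (induction k)
  case 0
  show ?case using assms by unfold_locales auto
next
  case (Suc k)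
  then show ?case using subadditive_profile.step by simp
qed

text \<open>The locale covers \<open>p \<le> 1 / 2\<close>. For larger \<open>p\<close> the profile
  is the reflection of the one for \<open>1 - p\<close>, and \<open>x \<mapsto> 1 - x\<close>
  exchanges subadditivity with its wrapped form.\<close>

lemma lex_profile_subadd:
  assumes "0 < p" "p < 1" "0 \<le> a" "0 \<le> b" "a + b \<le> 1"
  shows "lex_profile p k (a + b) \<le> lex_profile p k a + lex_profile p k b"
proof (cases "p \<le> 1 / 2")
  case True
  interpret subadditive_profile p "1 - p" "p / (1 - p)" "(1 - p) / p" "lex_profile p k"
    using True assms by (intro lex_profile_subadditive_half)
  show ?thesis using assms by (intro subadd)
next
  case False
  interpret subadditive_profile "1 - p" "1 - (1 - p)" "(1 - p) / (1 - (1 - p))"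
    "(1 - (1 - p)) / (1 - p)" "lex_profile (1 - p) k"
    using False assms by (intro lex_profile_subadditive_half) auto
  show ?thesis using subadd_wrap[of "1 - a" "1 - b"] assms
    by (simp add: lex_profile_dual diff_diff_eq2 add.commute)
qed

lemma lex_profile_subadd_wrap:
  assumes "0 < p" "p < 1" "a \<le> 1" "b \<le> 1" "1 \<le> a + b"
  shows "lex_profile p k (a + b - 1) \<le> lex_profile p k a + lex_profile p k b"
proof -
  have "lex_profile (1 - p) k ((1 - a) + (1 - b))
      \<le> lex_profile (1 - p) k (1 - a) + lex_profile (1 - p) k (1 - b)"
    using assms by (intro lex_profile_subadd) auto
  then show ?thesis using assms by (simp add: lex_profile_dual algebra_simps)
qed

section \<open>The two-point inequality\<close>

text \<open>The average of the two points is \<open>p * (p + q * s)\<close> with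
  \<open>s = a + b\<close>, or \<open>p + q * (p * s)\<close> with \<open>s = a + b - 1\<close>. One
  step of the recursion leaves \<open>H\<close> at the inner point; \<open>incr\<close> replaces it
  there by \<open>lex_step p H\<close>, which unfolds to \<open>H s\<close>.\<close>

lemma lex_step_two_point_cross:
  fixes p q :: real and H :: "real \<Rightarrow> real"
  assumes pq: "0 < p" "0 < q" "p + q = 1" and ends: "H 0 = 0" "H 1 = 0"
    and subadd: "\<And>a b. 0 \<le> a \<Longrightarrow> 0 \<le> b \<Longrightarrow> a + b \<le> 1 \<Longrightarrow> H (a + b) \<le> H a + H b"
    and wrap: "\<And>a b. a \<le> 1 \<Longrightarrow> b \<le> 1 \<Longrightarrow> 1 \<le> a + b \<Longrightarrow> H (a + b - 1) \<le> H a + H b"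
    and incr: "\<And>x. x \<in> {0..1} \<Longrightarrow> H x \<le> lex_step p H x"
    and ab: "0 \<le> a" "a \<le> 1" "0 \<le> b" "b \<le> 1"
  shows "lex_step p H (p * (p + q * a) + q * (p * b))
    \<le> p * lex_step p H (p + q * a) + q * lex_step p H (p * b) + ((p + q * a) - p * b)"
proof -
  note low = lex_step_low[OF pq(1)] and high = lex_step_high[OF pq _ ends]
  have Ta: "lex_step p H (p + q * a) = q * H a + 1 - a" using ab by (intro high)
  have Tb: "lex_step p H (p * b) = p * H b + b" using ab by (intro low)
  show ?thesis
  proof (cases "a + b \<le> 1")
    case True
    let ?s = "a + b"
    have s: "p + q * ?s \<in> {0..1}"
    proof -
      have "q * ?s \<le> q * 1" "0 \<le> q * ?s" using True ab pq by (auto intro: mult_left_mono)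
      then show ?thesis using pq unfolding atLeastAtMost_iff by linarith
    qed
    have e: "p * (p + q * a) + q * (p * b) = p * (p + q * ?s)" by (simp add: algebra_simps)
    have "H (p + q * ?s) \<le> q * H ?s + 1 - ?s" using incr[OF s] high[of ?s] ab by simp
    also have "q * H ?s \<le> q * (H a + H b)" using True ab pq by (intro mult_left_mono subadd) auto
    finally have "p * H (p + q * ?s) \<le> p * (q * (H a + H b) + 1 - ?s)" using pq by simp
    moreover have T: "lex_step p H (p * (p + q * ?s)) = p * H (p + q * ?s) + (p + q * ?s)"
      using s by (intro low) auto
    ultimately show ?thesis unfolding e T Ta Tb by (simp add: algebra_simps)
  next
    case False
    let ?s = "a + b - 1"
    have s: "0 \<le> ?s" "?s \<le> 1" using False ab by auto
    have ps: "p * ?s \<in> {0..1}" using s pq by (simp add: mult_le_one)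
    have q: "q = 1 - p" using pq by simp
    have e: "p * (p + q * a) + q * (p * b) = p + q * (p * ?s)" unfolding q by (simp add: algebra_simps)
    have "H (p * ?s) \<le> p * H ?s + ?s" using incr[OF ps] low[of ?s] s by simp
    also have "p * H ?s \<le> p * (H a + H b)" using False ab pq by (intro mult_left_mono wrap) auto
    finally have "q * H (p * ?s) \<le> q * (p * (H a + H b) + ?s)" using pq by simp
    moreover have T: "lex_step p H (p + q * (p * ?s)) = q * H (p * ?s) + 1 - p * ?s"
      using ps by (intro high) auto
    ultimately show ?thesis unfolding e T Ta Tb by (simp add: algebra_simps q)
  qed
qed

lemma lex_profile_two_point:
  assumes p: "0 < p" "p < 1" and ab: "0 \<le> b" "b \<le> a" "a \<le> 1"
  shows "lex_profile p k (p * a + (1 - p) * b)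
    \<le> p * lex_profile p k a + (1 - p) * lex_profile p k b + (a - b)"
  using ab
proof (induction k arbitrary: a b)
  case (Suc k)
  define q where "q = 1 - p"
  have q: "0 < q" "p + q = 1" using p by (auto simp: q_def)
  let ?H = "lex_profile p k"
  note low = lex_step_low[OF p(1), of _ ?H]
    and high = lex_step_high[OF p(1) q _ lex_profile_0[OF p, of k] lex_profile_1[OF p, of k]]
  have IH: "?H (p * a + q * b) \<le> p * ?H a + q * ?H b + (a - b)" if "0 \<le> b" "b \<le> a" "a \<le> 1" for a b
    using Suc.IH that by (simp add: q_def)
  have bnd: "0 \<le> p * a + q * b" "p * a + q * b \<le> 1" if "0 \<le> b" "b \<le> a" "a \<le> 1" for a b
    using that p q convex_bound_le[of a 1 b p q] by auto
  have a: "0 \<le> a" and b: "b \<le> 1" using Suc.prems by auto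
  have "lex_step p ?H (p * a + q * b) \<le> p * lex_step p ?H a + q * lex_step p ?H b + (a - b)"
  proof (cases rule: unit_interval_split[OF p(1) q a Suc.prems(3), case_names low high])
    case l: (low s)
    show ?thesis
    proof (cases rule: unit_interval_split[OF p(1) q Suc.prems(1) b, case_names low high])
      case l': (low t)
      have ts: "t \<le> s" using l l' Suc.prems p by simp
      have e: "p * a + q * b = p * (p * s + q * t)" using l l' by (simp add: algebra_simps)
      have "p * ?H (p * s + q * t) \<le> p * (p * ?H s + q * ?H t + (s - t))"
        using IH[OF l'(1) ts l(2)] p by simp
      then show ?thesis using bnd[OF l'(1) ts l(2)] l l' unfolding e
        by (simp add: low) (simp add: algebra_simps)
    next
      case (high t)
      \<comment> \<open>With \<open>b \<le> a\<close>, a low \<open>a\<close> and a high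
        \<open>b\<close> can only meet at the breakpoint.\<close>
      have "a = p" "b = p" using l(4) high(4) Suc.prems by auto
      then show ?thesis using q by (simp flip: distrib_right)
    qed
  next
    case h: (high s)
    show ?thesis
    proof (cases rule: unit_interval_split[OF p(1) q Suc.prems(1) b, case_names low high])
      case l: (low t)
      show ?thesis unfolding l(3) h(3)
        by (intro lex_step_two_point_cross p q lex_profile_0 lex_profile_1 lex_profile_subadd
            lex_profile_subadd_wrap lex_profile_increasing l h)
    next
      case h': (high t)
      have ts: "t \<le> s" using h h' Suc.prems q by simp
      have "p * a + q * b = (p + q) * p + q * (p * s + q * t)"
        using h h' by (simp add: algebra_simps)
      then have e: "p * a + q * b = p + q * (p * s + q * t)" using q(2) by simp
      have "q * ?H (p * s + q * t) \<le> q * (p * ?H s + q * ?H t + (s - t))"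
        using IH[OF h'(1) ts h(2)] q by simp
      moreover have "lex_step p ?H (p + q * (p * s + q * t)) = q * ?H (p * s + q * t) + 1 - (p * s + q * t)"
        using bnd[OF h'(1) ts h(2)] by (intro high) auto
      moreover have Ta: "lex_step p ?H a = q * ?H s + 1 - s" unfolding h(3) using h(1) by (rule high)
      moreover have Tb: "lex_step p ?H b = q * ?H t + 1 - t" unfolding h'(3) using h'(1) by (rule high)
      moreover have "a - b = q * (s - t)" using h(3) h'(3) by (simp add: algebra_simps)
      moreover have "q * (p * ?H s + q * ?H t + (s - t)) + 1 - (p * s + q * t) =
          p * (q * ?H s + 1 - s) + q * (q * ?H t + 1 - t) + q * (s - t)"
        using q(2) by (simp add: algebra_simps)
      ultimately show ?thesis unfolding e Ta Tb by linarith
    qed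
  qed
  then show ?case by (simp add: q_def)
qed simp

section \<open>Monotone families on finitely many coordinates\<close>

lemma card_pivotal: "card (F \<inter> {S, sym_diff S {i}}) = 1 \<longleftrightarrow> (S \<in> F) \<noteq> (sym_diff S {i} \<in> F)"
proof -
  have "S \<noteq> sym_diff S {i}" by auto
  then show ?thesis by (cases "S \<in> F"; cases "sym_diff S {i} \<in> F") (auto simp: Int_insert_right)
qed

text \<open>Splitting off the last coordinate rather than the first leaves both sections on
  \<open>{1..n}\<close>, without renumbering.\<close>

lemma measure_biased_fin_Suc:
  assumes p: "0 \<le> p" "p \<le> 1" and F: "F \<subseteq> Pow {1..Suc n}"
  shows "measure (biased_fin p (Suc n)) F =
    p * measure (biased_fin p n) {S \<in> Pow {1..n}. insert (Suc n) S \<in> F} +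
    (1 - p) * measure (biased_fin p n) (F \<inter> Pow {1..n})"
proof -
  let ?F1 = "{S \<in> Pow {1..n}. insert (Suc n) S \<in> F}" and ?F0 = "F \<inter> Pow {1..n}"
  let ?w = "\<lambda>n S. p ^ card S * (1 - p) ^ (n - card S)"
  have fin: "finite ?F1" "finite ?F0" by (auto intro: finite_subset[of _ "Pow {1..n}"])
  have notin: "Suc n \<notin> S" if "S \<in> Pow {1..n}" for S using that by auto
  have fS: "finite S" "card S \<le> n" if "S \<in> Pow {1..n}" for S
    using that card_mono[of "{1..n}" S] by (auto intro: finite_subset)
  have split: "F = insert (Suc n) ` ?F1 \<union> ?F0"
  proof (intro equalityI subsetI)
    fix S assume S: "S \<in> F"
    show "S \<in> insert (Suc n) ` ?F1 \<union> ?F0"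
    proof (cases "Suc n \<in> S")
      case True
      then have "S = insert (Suc n) (S - {Suc n})" by auto
      moreover have "S - {Suc n} \<subseteq> {1..n}" using S F by (auto simp: atLeastAtMostSuc_conv)
      ultimately have "S - {Suc n} \<in> ?F1" using S by (auto simp: insert_absorb)
      then show ?thesis using \<open>S = insert (Suc n) (S - {Suc n})\<close> by blast
    next
      case False
      then show ?thesis using S F by (auto simp: atLeastAtMostSuc_conv)
    qed
  qed auto
  have "measure (biased_fin p (Suc n)) F = sum (?w (Suc n)) F"
    using measure_biased_fin[OF p F] .
  also have "\<dots> = sum (?w (Suc n)) (insert (Suc n) ` ?F1) + sum (?w (Suc n)) ?F0"
    by (subst split, rule sum.union_disjoint) (use fin notin in auto)
  also have "sum (?w (Suc n)) (insert (Suc n) ` ?F1) = (\<Sum>S\<in>?F1. ?w (Suc n) (insert (Suc n) S))"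
    using notin by (subst sum.reindex) (auto simp: inj_on_def insert_ident)
  also have "\<dots> = (\<Sum>S\<in>?F1. p * ?w n S)"
    using fS notin by (intro sum.cong) auto
  also have "sum (?w (Suc n)) ?F0 = (\<Sum>S\<in>?F0. (1 - p) * ?w n S)"
    using fS by (intro sum.cong) (auto simp: Suc_diff_le)
  finally have "measure (biased_fin p (Suc n)) F = p * sum (?w n) ?F1 + (1 - p) * sum (?w n) ?F0"
    by (simp only: sum_distrib_left)
  moreover have "?F1 \<subseteq> Pow {1..n}" "?F0 \<subseteq> Pow {1..n}" by auto
  ultimately show ?thesis by (simp only: measure_biased_fin[OF p])
qed

lemma prob_space_biased_fin:
  assumes p: "0 \<le> p" "p \<le> 1"
  shows "prob_space (biased_fin p n)"
proof -
  interpret finite_measure "biased_fin p n"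
    by (rule finite_measureI)
      (simp add: biased_fin_def emeasure_point_measure_finite space_point_measure)
  have "measure (biased_fin p n) (Pow {1..n}) = 1"
  proof (induction n)
    case 0
    then show ?case using measure_biased_fin[OF p, of "{{}}" 0] by simp
  next
    case (Suc n)
    have "{S \<in> Pow {1..n}. insert (Suc n) S \<in> Pow {1..Suc n}} = Pow {1..n}"
      "Pow {1..Suc n} \<inter> Pow {1..n} = Pow {1..n}" by auto
    from measure_biased_fin_Suc[OF p order_refl, of n, unfolded this] show ?case
      unfolding Suc.IH by simp
  qed
  then show ?thesis by (intro prob_spaceI) (simp add: emeasure_eq_measure)
qed

text \<open>Flipping a coordinate \<open>i \<le> n\<close> commutes with taking sections, so the
  sections of the pivotal family are the pivotal families of the sections.\<close>

lemma influence_biased_fin_Suc: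
  assumes p: "0 \<le> p" "p \<le> 1" and i: "i \<in> {1..n}"
  shows "influence (biased_fin p (Suc n)) F i =
    p * influence (biased_fin p n) {S \<in> Pow {1..n}. insert (Suc n) S \<in> F} i +
    (1 - p) * influence (biased_fin p n) (F \<inter> Pow {1..n}) i"
proof -
  let ?V = "\<lambda>n F. {S \<in> Pow {1..n}. (S \<in> F) \<noteq> (sym_diff S {i} \<in> F)}"
  let ?F1 = "{S \<in> Pow {1..n}. insert (Suc n) S \<in> F}" and ?F0 = "F \<inter> Pow {1..n}"
  have flip: "sym_diff S {i} \<in> Pow {1..n}" if "S \<in> Pow {1..n}" for S using that i by auto
  have ins: "sym_diff (insert (Suc n) S) {i} = insert (Suc n) (sym_diff S {i})" for S
    using i by auto
  have "{S \<in> Pow {1..n}. insert (Suc n) S \<in> ?V (Suc n) F} = ?V n ?F1"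
    using flip unfolding mem_Collect_eq ins by auto
  moreover have "?V (Suc n) F \<inter> Pow {1..n} = ?V n ?F0" using flip by auto
  ultimately show ?thesis
    using measure_biased_fin_Suc[OF p, of "?V (Suc n) F" n]
    unfolding influence_def card_pivotal space_biased_fin by auto
qed

text \<open>\<open>S\<close> and \<open>insert (Suc n) S\<close> are pivotal together, so both
  sections of the pivotal family equal \<open>?F1 - ?F0\<close>. Monotonicity gives
  \<open>?F0 \<subseteq> ?F1\<close>, which turns the measure of this set into a difference.\<close>

lemma influence_biased_fin_last:
  assumes p: "0 \<le> p" "p \<le> 1" and F: "monotone_increasing (Suc n) F"
  shows "influence (biased_fin p (Suc n)) F (Suc n) =
    measure (biased_fin p n) {S \<in> Pow {1..n}. insert (Suc n) S \<in> F} -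
    measure (biased_fin p n) (F \<inter> Pow {1..n})"
proof -
  let ?V = "{S \<in> Pow {1..Suc n}. (S \<in> F) \<noteq> (sym_diff S {Suc n} \<in> F)}"
  let ?F1 = "{S \<in> Pow {1..n}. insert (Suc n) S \<in> F}" and ?F0 = "F \<inter> Pow {1..n}"
  have notin: "Suc n \<notin> S" if "S \<in> Pow {1..n}" for S using that by auto
  have up: "insert (Suc n) S \<in> F" if "S \<in> F" "S \<in> Pow {1..n}" for S
  proof -
    have "insert (Suc n) S \<subseteq> {1..Suc n}" using that by auto
    then show ?thesis using F that unfolding monotone_increasing_def by blast
  qed
  have ins: "sym_diff (insert (Suc n) S) {Suc n} = S" "sym_diff S {Suc n} = insert (Suc n) S"
    "insert (Suc n) S \<in> Pow {1..Suc n}" "S \<in> Pow {1..Suc n}" if "S \<in> Pow {1..n}" for S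
    using that notin[OF that] by auto
  have V: "{S \<in> Pow {1..n}. insert (Suc n) S \<in> ?V} = ?F1 - ?F0" "?V \<inter> Pow {1..n} = ?F1 - ?F0"
    using ins up by auto
  have "measure (biased_fin p n) (?F1 - ?F0) = measure (biased_fin p n) ?F1 - measure (biased_fin p n) ?F0"
    using up by (intro finite_measure.finite_measure_Diff prob_space.finite_measure prob_space_biased_fin p) auto
  moreover have "measure (biased_fin p (Suc n)) ?V = measure (biased_fin p n) (?F1 - ?F0)"
  proof -
    have "?V \<subseteq> Pow {1..Suc n}" by auto
    from measure_biased_fin_Suc[OF p this] show ?thesis unfolding V by (simp flip: distrib_right)
  qed
  ultimately show ?thesis unfolding influence_def card_pivotal space_biased_fin by simp
qed

text \<open>The two-point inequality is applied to the measures of the two sections; its additive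
  term is exactly the influence of the last coordinate. The index \<open>k\<close> is independent of
  \<open>n\<close>, because a lexicographic family may depend on infinitely many
  coordinates.\<close>

lemma lex_profile_le_total_influence_fin:
  assumes p: "0 < p" "p < 1" and F: "monotone_increasing n F"
  shows "lex_profile p k (measure (biased_fin p n) F) \<le> total_influence_fin p n F"
  using F
proof (induction n arbitrary: F)
  case 0
  \<comment> \<open>These families have measure 0 and 1, where the profile vanishes.\<close>
  then have "F = {} \<or> F = {{}}" by (auto simp: monotone_increasing_def)
  then show ?case using p measure_biased_fin[of p F 0]
    by (auto simp: lex_profile_0 lex_profile_1 total_influence_fin_def)
next
  case (Suc n)
  let ?F1 = "{S \<in> Pow {1..n}. insert (Suc n) S \<in> F}" and ?F0 = "F \<inter> Pow {1..n}"
  let ?m = "measure (biased_fin p n)"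
  have p': "0 \<le> p" "p \<le> 1" using p by auto
  have up: "T \<in> F" if "S \<in> F" "S \<subseteq> T" "T \<subseteq> {1..Suc n}" for S T
    using Suc.prems that unfolding monotone_increasing_def by blast
  have F1: "monotone_increasing n ?F1" unfolding monotone_increasing_def
  proof (intro conjI allI impI)
    fix S T assume "S \<in> ?F1" "S \<subseteq> T" "T \<subseteq> {1..n}"
    moreover from this have "insert (Suc n) S \<subseteq> insert (Suc n) T" "insert (Suc n) T \<subseteq> {1..Suc n}"
      by auto
    ultimately show "T \<in> ?F1" using up by blast
  qed auto
  have F0: "monotone_increasing n ?F0" unfolding monotone_increasing_def
  proof (intro conjI allI impI)
    fix S T assume "S \<in> ?F0" "S \<subseteq> T" "T \<subseteq> {1..n}"
    moreover from this have "T \<subseteq> {1..Suc n}" by auto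
    ultimately show "T \<in> ?F0" using up[of S T] by simp
  qed auto
  have le: "?m ?F0 \<le> ?m ?F1"
  proof -
    have "insert (Suc n) S \<in> F" if "S \<in> ?F0" for S
      by (rule up[of S]) (use that in auto)
    then have "?F0 \<subseteq> ?F1" by auto
    moreover have "finite_measure (biased_fin p n)"
      by (intro prob_space.finite_measure prob_space_biased_fin p')
    ultimately show ?thesis by (intro finite_measure.finite_measure_mono) auto
  qed
  have prob: "?m ?F1 \<le> 1"
    by (intro prob_space.prob_le_1 prob_space_biased_fin p')
  have "lex_profile p k (measure (biased_fin p (Suc n)) F) =
      lex_profile p k (p * ?m ?F1 + (1 - p) * ?m ?F0)"
    using Suc.prems by (subst measure_biased_fin_Suc[OF p']) (auto simp: monotone_increasing_def)
  also have "\<dots> \<le> p * lex_profile p k (?m ?F1) + (1 - p) * lex_profile p k (?m ?F0) + (?m ?F1 - ?m ?F0)"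
    using p le prob by (intro lex_profile_two_point) auto
  also have "\<dots> \<le> p * total_influence_fin p n ?F1 + (1 - p) * total_influence_fin p n ?F0
      + influence (biased_fin p (Suc n)) F (Suc n)"
    unfolding influence_biased_fin_last[OF p' Suc.prems] using p
    by (intro add_mono mult_left_mono Suc.IH F1 F0) auto
  also have "\<dots> = total_influence_fin p (Suc n) F"
    by (simp add: total_influence_fin_def influence_biased_fin_Suc[OF p'] sum.distrib sum_distrib_left)
  finally show ?case .
qed

section \<open>Influences of the lexicographic families\<close>

definition cylinder :: "nat \<Rightarrow> nat set \<Rightarrow> nat set set" where
  "cylinder n T = {S \<in> Pow {1..}. S \<inter> {1..n} = T}"

lemma cylinder_in_sets: "cylinder n T \<in> sets (biased_seq p)"
  unfolding sets_biased_seq cylinder_def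
  by (intro sigma_sets.Basic CollectI finitely_determined_cylinder)

lemma measure_cylinder:
  assumes "0 \<le> p" "p \<le> 1" "T \<subseteq> {1..n}"
  shows "measure (biased_seq p) (cylinder n T) = p ^ card T * (1 - p) ^ (n - card T)"
  using assms emeasure_biased_seq_cylinder[OF assms] by (simp add: measure_def cylinder_def)

definition bernoulli_weight :: "real \<Rightarrow> bool \<Rightarrow> real" where
  "bernoulli_weight p b = (if b then p else 1 - p)"

lemma measure_cylinder_Suc:
  assumes p: "0 \<le> p" "p \<le> 1" and T: "T \<subseteq> {1..Suc n}"
  shows "measure (biased_seq p) (cylinder (Suc n) T) =
    bernoulli_weight p (Suc n \<in> T) * measure (biased_seq p) (cylinder n (T - {Suc n}))"
proof -
  have T': "T - {Suc n} \<subseteq> {1..n}" using T by (auto simp: atLeastAtMostSuc_conv)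
  then have c: "card (T - {Suc n}) \<le> n" using card_mono[OF _ T'] by simp
  have fin: "finite T" using T by (auto intro: finite_subset)
  show ?thesis
  proof (cases "Suc n \<in> T")
    case True
    define m where "m = card (T - {Suc n})"
    have "card T = Suc m" using fin True unfolding m_def by (intro card.remove)
    then show ?thesis
      using True unfolding measure_cylinder[OF p T] measure_cylinder[OF p T'] m_def[symmetric]
      by (simp add: bernoulli_weight_def)
  next
    case False
    then show ?thesis using T T' p c by (simp add: measure_cylinder bernoulli_weight_def Suc_diff_le)
  qed
qed

section \<open>Flipping one coordinate\<close>

definition flip :: "nat \<Rightarrow> nat set set \<Rightarrow> nat set set" where
  "flip i A = {S \<in> Pow {1..}. sym_diff S {i} \<in> A}"

lemma flip_Int: "flip i (X \<inter> Y) = flip i X \<inter> flip i Y"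
  by (auto simp: flip_def)

lemma flip_cylinder:
  assumes "i \<in> {1..n}"
  shows "flip i (cylinder n T) = cylinder n (sym_diff T {i})"
  using assms unfolding flip_def cylinder_def by (auto; blast)

text \<open>A flip replaces one factor \<open>p\<close> by \<open>1 - p\<close> or conversely; the
  relation is cross-multiplied to avoid quotients.\<close>

lemma measure_flip_cylinder:
  assumes p: "0 \<le> p" "p \<le> 1" and T: "T \<subseteq> {1..n}" and i: "i \<in> {1..n}"
  shows "bernoulli_weight p (i \<in> T) * measure (biased_seq p) (flip i (cylinder n T)) =
    bernoulli_weight p (i \<notin> T) * measure (biased_seq p) (cylinder n T)"
proof -
  have *: "(1 - p) * measure (biased_seq p) (cylinder n (insert i U)) = p * measure (biased_seq p) (cylinder n U)"
    if U: "U \<subseteq> {1..n}" "i \<notin> U" for U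
  proof -
    have fin: "finite U" using U by (auto intro: finite_subset)
    have iU: "insert i U \<subseteq> {1..n}" using U i by auto
    have "card (insert i U) \<le> n" using card_mono[OF _ iU] by simp
    then have "n - card U = Suc (n - card (insert i U))" using fin U by simp
    then show ?thesis using U iU p fin by (simp add: measure_cylinder)
  qed
  show ?thesis
  proof (cases "i \<in> T")
    case True
    then have "sym_diff T {i} = T - {i}" "insert i (T - {i}) = T" by auto
    then show ?thesis using True *[of "T - {i}"] T i
      by (simp add: flip_cylinder bernoulli_weight_def subset_iff)
  next
    case False
    then have "sym_diff T {i} = insert i T" by auto
    then show ?thesis using False *[of T] T i by (auto simp: flip_cylinder bernoulli_weight_def)
  qed
qed

text \<open>Each cylinder changes its measure by the same ratio because all patterns
  \<open>T j\<close> agree on whether they contain \<open>i\<close>; countable additivity carries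
  the ratio over to the union.\<close>

lemma measure_flip_UN_cylinder:
  assumes p: "0 \<le> p" "p \<le> 1"
    and T: "\<And>j. j \<in> J \<Longrightarrow> T j \<subseteq> {1..j}" and i: "\<And>j. j \<in> J \<Longrightarrow> i \<in> {1..j}"
    and b: "\<And>j. j \<in> J \<Longrightarrow> i \<in> T j \<longleftrightarrow> b"
    and disj: "disjoint_family_on (\<lambda>j. cylinder j (T j)) J"
  shows "flip i (\<Union>j\<in>J. cylinder j (T j)) \<in> sets (biased_seq p)"
    and "bernoulli_weight p b * measure (biased_seq p) (flip i (\<Union>j\<in>J. cylinder j (T j))) =
      bernoulli_weight p (\<not> b) * measure (biased_seq p) (\<Union>j\<in>J. cylinder j (T j))"
proof -
  interpret prob_space "biased_seq p" by (rule prob_space_biased_seq)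
  \<comment> \<open>Empty sets fill the indices outside \<open>J\<close>, so that countable
    additivity over all naturals applies.\<close>
  define C where "C j = (if j \<in> J then cylinder j (T j) else {})" for j
  have sets: "C j \<in> events" "flip i (C j) \<in> events" for j
    using i by (auto simp: C_def cylinder_in_sets flip_cylinder) (simp add: flip_def)
  have C: "(\<Union>j\<in>J. cylinder j (T j)) = (\<Union>j. C j)" by (auto simp: C_def split: if_splits)
  have fC: "flip i (\<Union>j\<in>J. cylinder j (T j)) = (\<Union>j. flip i (C j))"
    unfolding C by (auto simp: flip_def)
  show "flip i (\<Union>j\<in>J. cylinder j (T j)) \<in> events" unfolding fC using sets by auto
  have d: "disjoint_family C"
    using disj by (auto simp: disjoint_family_on_def C_def)
  then have df: "disjoint_family (\<lambda>j. flip i (C j))"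
    unfolding disjoint_family_on_def flip_def by blast
  have "bernoulli_weight p b * prob (flip i (C j)) = bernoulli_weight p (\<not> b) * prob (C j)" for j
  proof (cases "j \<in> J")
    case True
    then show ?thesis using measure_flip_cylinder[OF p T[OF True] i[OF True]] b[OF True]
      by (simp add: C_def)
  qed (simp add: C_def flip_def)
  moreover have "(\<lambda>j. bernoulli_weight p b * prob (flip i (C j))) sums
      (bernoulli_weight p b * prob (\<Union>j. flip i (C j)))"
    using sets df by (intro sums_mult finite_measure_UNION) auto
  moreover have "(\<lambda>j. bernoulli_weight p (\<not> b) * prob (C j)) sums
      (bernoulli_weight p (\<not> b) * prob (\<Union>j. C j))"
    using sets d by (intro sums_mult finite_measure_UNION) auto
  ultimately show "bernoulli_weight p b * prob (flip i (\<Union>j\<in>J. cylinder j (T j))) =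
      bernoulli_weight p (\<not> b) * prob (\<Union>j\<in>J. cylinder j (T j))"
    unfolding C fC[unfolded C] by (simp add: sums_iff)
qed

section \<open>Lexicographic families given by a set of positions\<close>

text \<open>The nontrivial branch of \<open>lex_family\<close>, with an arbitrary set
  \<open>B\<close> in place of the binary positions.\<close>

definition lex_initial :: "nat set \<Rightarrow> nat set set" where
  "lex_initial B = (\<Union>i\<in>B. cylinder i ({1..i} - {k \<in> B. k < i}))"

text \<open>The sets in \<open>tied B n\<close> are those whose membership in \<open>lex_initial B\<close> is not yet decided by
  the coordinates up to \<open>n\<close>.\<close>
definition tied :: "nat set \<Rightarrow> nat \<Rightarrow> nat set set" where
  "tied B n = cylinder n ({1..n} - B)"

lemma lex_initial_cases:
  assumes "S \<in> lex_initial B"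
  obtains "S \<in> tied B n"
  | j where "j \<in> B" "j \<le> n" "S \<in> cylinder j ({1..j} - {k \<in> B. k < j})"
proof -
  from assms obtain j where j: "j \<in> B" "S \<in> cylinder j ({1..j} - {k \<in> B. k < j})"
    unfolding lex_initial_def by auto
  show thesis
  proof (cases "j \<le> n")
    case True
    then show ?thesis using j that by blast
  next
    case False
    then have "S \<inter> {1..n} = (S \<inter> {1..j}) \<inter> {1..n}" by auto
    also have "\<dots> = {1..n} - B" using j(2) False unfolding cylinder_def by auto
    finally have "S \<in> tied B n" using j(2) by (simp add: tied_def cylinder_def)
    then show ?thesis using that by blast
  qed
qed

text \<open>A set in the cylinder of position \<open>j\<close> contains \<open>j\<close>, whereas a
  tied set avoids \<open>B\<close> up to \<open>n\<close>; hence \<open>n < j\<close>. This form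
  exposes the tied part to \<open>measure_flip_UN_cylinder\<close>.\<close>

lemma lex_initial_tied:
  assumes B: "B \<subseteq> {1..}"
  shows "lex_initial B \<inter> tied B n = (\<Union>j\<in>{j \<in> B. n < j}. cylinder j ({1..j} - {k \<in> B. k < j}))"
    (is "?L = ?R")
proof (intro equalityI subsetI)
  fix S assume S: "S \<in> ?L"
  then obtain j where j: "j \<in> B" "S \<in> cylinder j ({1..j} - {k \<in> B. k < j})"
    unfolding lex_initial_def by auto
  have "j \<in> S"
  proof -
    have "j \<in> {1..j} - {k \<in> B. k < j}" using j B by auto
    also have "\<dots> \<subseteq> S" using j(2) unfolding cylinder_def by auto
    finally show ?thesis .
  qed
  have "n < j"
  proof (rule ccontr)
    assume "\<not> n < j"
    then have "j \<in> S \<inter> {1..n}" using \<open>j \<in> S\<close> j B by auto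
    also have "\<dots> = {1..n} - B" using S by (simp add: tied_def cylinder_def)
    finally show False using j by simp
  qed
  then show "S \<in> ?R" using j by auto
next
  fix S assume "S \<in> ?R"
  then obtain j where j: "j \<in> B" "n < j" "S \<in> cylinder j ({1..j} - {k \<in> B. k < j})" by auto
  have "S \<inter> {1..n} = (S \<inter> {1..j}) \<inter> {1..n}" using j by auto
  also have "\<dots> = {1..n} - B" using j unfolding cylinder_def by auto
  finally have "S \<in> tied B n" using j(3) by (simp add: tied_def cylinder_def)
  then show "S \<in> ?L" using j by (auto simp: lex_initial_def)
qed

lemma flip_tied: "flip (Suc n) (tied B (Suc n)) = cylinder (Suc n) (sym_diff ({1..Suc n} - B) {Suc n})"
  unfolding tied_def by (rule flip_cylinder) simp

text \<open>Such a set leaves the pattern \<open>- B\<close> first at \<open>Suc n\<close>, which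
  decides its membership. If \<open>Suc n \<in> B\<close>, it contains \<open>Suc n\<close> and lies
  in the cylinder of that position; otherwise it lacks a coordinate that every later cylinder
  requires.\<close>

lemma flip_tied_mem_lex_initial:
  assumes B: "B \<subseteq> {1..}" and S: "S \<in> flip (Suc n) (tied B (Suc n))"
  shows "S \<in> lex_initial B \<longleftrightarrow> Suc n \<in> B"
proof
  assume "Suc n \<in> B"
  moreover from this have "sym_diff ({1..Suc n} - B) {Suc n} = {1..Suc n} - {k \<in> B. k < Suc n}" by auto
  ultimately show "S \<in> lex_initial B" using S unfolding flip_tied lex_initial_def by auto
next
  assume "S \<in> lex_initial B"
  moreover have tied: "S \<in> tied B n"
  proof -
    have "S \<inter> {1..n} = (S \<inter> {1..Suc n}) \<inter> {1..n}" by auto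
    also have "S \<inter> {1..Suc n} = sym_diff ({1..Suc n} - B) {Suc n}"
      using S by (simp add: flip_tied cylinder_def)
    also have "\<dots> \<inter> {1..n} = {1..n} - B" by auto
    finally have "S \<inter> {1..n} = {1..n} - B" .
    moreover have "S \<in> Pow {1..}" using S by (simp add: flip_def)
    ultimately show ?thesis by (simp add: tied_def cylinder_def)
  qed
  ultimately obtain j where j: "j \<in> B" "n < j" "S \<in> cylinder j ({1..j} - {k \<in> B. k < j})"
    using lex_initial_tied[OF B, of n] by blast
  show "Suc n \<in> B"
  proof (rule ccontr)
    assume nB: "Suc n \<notin> B"
    then have "Suc n \<in> {1..j} - {k \<in> B. k < j}" using j by auto
    also have "\<dots> \<subseteq> S" using j(3) unfolding cylinder_def by auto
    finally have "Suc n \<in> S \<inter> {1..Suc n}" by auto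
    also have "\<dots> = sym_diff ({1..Suc n} - B) {Suc n}" using S by (simp add: flip_tied cylinder_def)
    finally show False using nB by auto
  qed
qed

lemma tied_Suc: "tied B n = tied B (Suc n) \<union> flip (Suc n) (tied B (Suc n))"
proof -
  have eq: "X = Y \<longleftrightarrow> X' = Y' \<or> X' = sym_diff Y' {m}"
    if "X' = (if a then insert m X else X)" "Y' = (if b then insert m Y else Y)" "m \<notin> X" "m \<notin> Y"
    for X Y X' Y' :: "nat set" and m a b
    using that by (cases a; cases b) auto
  have "S \<inter> {1..n} = {1..n} - B \<longleftrightarrow> S \<inter> {1..Suc n} = {1..Suc n} - B \<or>
    S \<inter> {1..Suc n} = sym_diff ({1..Suc n} - B) {Suc n}" for S
    by (rule eq[where a = "Suc n \<in> S" and b = "Suc n \<notin> B"]) (auto simp: le_Suc_eq)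
  then show ?thesis unfolding flip_tied unfolding tied_def cylinder_def by auto
qed

text \<open>Coordinate \<open>Suc n\<close> matters only for sets tied up to \<open>n\<close>. Of
  \<open>S\<close> and its flip, one stays tied and the other is decided, belonging to the family
  iff \<open>Suc n \<in> B\<close>; pivotality forces the tied one to behave oppositely. This
  inclusion yields upper bounds on influences.\<close>

lemma pivotal_lex_initial:
  assumes B: "B \<subseteq> {1..}"
    and S: "S \<in> Pow {1..}" "(S \<in> lex_initial B) \<noteq> (sym_diff S {Suc n} \<in> lex_initial B)"
  shows "S \<in> tied B (Suc n) \<and> (S \<in> lex_initial B \<longleftrightarrow> Suc n \<notin> B) \<or>
    S \<in> flip (Suc n) (tied B (Suc n)) \<and> (S \<in> flip (Suc n) (lex_initial B) \<longleftrightarrow> Suc n \<notin> B)"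
proof -
  let ?f = "\<lambda>S. sym_diff S {Suc n}"
  have f: "?f S \<in> Pow {1..}" "?f (?f S) = S" using S by auto
  \<comment> \<open>A witness position \<open>j \<le> n\<close> does not see coordinate
    \<open>Suc n\<close> and would put the flip of \<open>U\<close> into the family as well.\<close>
  have "U \<in> tied B n" if U: "U \<in> lex_initial B" "?f U \<notin> lex_initial B" "U \<in> Pow {1..}" for U
    using U(1)
  proof (cases rule: lex_initial_cases[of _ _ n])
    case (2 j)
    then have "?f U \<inter> {1..j} = U \<inter> {1..j}" "?f U \<in> Pow {1..}" using U(3) by auto
    then have "?f U \<in> cylinder j ({1..j} - {k \<in> B. k < j})" using 2(3) by (simp add: cylinder_def)
    then show ?thesis using U(2) 2(1) by (auto simp: lex_initial_def)
  qed
  from this[of S] this[of "?f S"] have "S \<in> tied B n \<or> ?f S \<in> tied B n"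
    using S f by metis
  moreover have "?f S \<in> tied B n \<longleftrightarrow> S \<in> tied B n"
  proof -
    have "?f S \<inter> {1..n} = S \<inter> {1..n}" by auto
    then show ?thesis using f S by (simp add: tied_def cylinder_def)
  qed
  ultimately have "S \<in> tied B n" by blast
  then consider "S \<in> tied B (Suc n)" | "S \<in> flip (Suc n) (tied B (Suc n))"
    unfolding tied_Suc[of B n] by blast
  then show ?thesis
  proof cases
    case 1
    then have "?f S \<in> flip (Suc n) (tied B (Suc n))" using f by (simp add: flip_def)
    from flip_tied_mem_lex_initial[OF B this] show ?thesis using S 1 by blast
  next
    case 2
    from flip_tied_mem_lex_initial[OF B this] show ?thesis using S 2 by (auto simp: flip_def)
  qed
qed

section \<open>Influences for a fixed set of positions\<close>

context
  fixes p :: real and B :: "nat set"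
  assumes p: "0 < p" "p < 1" and B: "B \<subseteq> {1..}"
begin

interpretation prob_space "biased_seq p" by (rule prob_space_biased_seq)

private lemma p_bounds: "0 \<le> p" "p \<le> 1" using p by auto

lemma lex_initial_in_sets: "lex_initial B \<in> events"
  unfolding lex_initial_def by (intro sets.countable_UN'' cylinder_in_sets) auto

lemma tied_in_sets: "tied B n \<in> events" "flip (Suc n) (tied B (Suc n)) \<in> events"
  unfolding flip_tied unfolding tied_def by (rule cylinder_in_sets)+

lemma prob_tied_pos: "0 < prob (tied B n)"
  using p by (simp add: tied_def measure_cylinder)

lemma prob_tied_Suc:
  "prob (tied B (Suc n)) = bernoulli_weight p (Suc n \<notin> B) * prob (tied B n)"
  "prob (flip (Suc n) (tied B (Suc n))) = bernoulli_weight p (Suc n \<in> B) * prob (tied B n)"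
proof -
  have e: "{1..Suc n} - B - {Suc n} = {1..n} - B"
    "sym_diff ({1..Suc n} - B) {Suc n} - {Suc n} = {1..n} - B" by auto
  have mem: "Suc n \<in> {1..Suc n} - B \<longleftrightarrow> Suc n \<notin> B"
    "Suc n \<in> sym_diff ({1..Suc n} - B) {Suc n} \<longleftrightarrow> Suc n \<in> B" by auto
  have sub: "sym_diff ({1..Suc n} - B) {Suc n} \<subseteq> {1..Suc n}" by auto
  show "prob (tied B (Suc n)) = bernoulli_weight p (Suc n \<notin> B) * prob (tied B n)"
    using measure_cylinder_Suc[OF p_bounds Diff_subset, of n B] unfolding e mem tied_def .
  show "prob (flip (Suc n) (tied B (Suc n))) = bernoulli_weight p (Suc n \<in> B) * prob (tied B n)"
    using measure_cylinder_Suc[OF p_bounds sub] unfolding e(2) mem(2) flip_tied unfolding tied_def .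
qed

text \<open>The positions involved all exceed \<open>Suc n\<close>, so every pattern contains
  \<open>Suc n\<close> exactly when \<open>Suc n \<notin> B\<close>, as
  \<open>measure_flip_UN_cylinder\<close> requires.\<close>

lemma prob_flip_lex_initial_tied:
  "flip (Suc n) (lex_initial B \<inter> tied B (Suc n)) \<in> events"
  "bernoulli_weight p (Suc n \<notin> B) * prob (flip (Suc n) (lex_initial B \<inter> tied B (Suc n))) =
    bernoulli_weight p (Suc n \<in> B) * prob (lex_initial B \<inter> tied B (Suc n))"
proof -
  let ?T = "\<lambda>j. {1..j} - {k \<in> B. k < j}"
  have disj: "disjoint_family_on (\<lambda>j. cylinder j (?T j)) {j \<in> B. Suc n < j}"
    unfolding disjoint_family_on_def
  proof (intro ballI impI)
    \<comment> \<open>The smaller position \<open>j\<close> belongs to its own pattern but is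
      removed from the pattern of \<open>l\<close>.\<close>
    have *: "cylinder j (?T j) \<inter> cylinder l (?T l) = {}" if "j \<in> B" "j < l" for j l
    proof (rule ccontr)
      assume "cylinder j (?T j) \<inter> cylinder l (?T l) \<noteq> {}"
      then obtain S where S: "S \<inter> {1..j} = ?T j" "S \<inter> {1..l} = ?T l" by (auto simp: cylinder_def)
      have "j \<in> ?T j" "j \<notin> ?T l" "j \<in> {1..l}" using that B by auto
      then show False using S by blast
    qed
    fix j l assume "j \<in> {j \<in> B. Suc n < j}" "l \<in> {j \<in> B. Suc n < j}" "j \<noteq> l"
    then show "cylinder j (?T j) \<inter> cylinder l (?T l) = {}"
      using *[of j l] *[of l j] by (cases j l rule: linorder_cases) auto
  qed
  note flip = measure_flip_UN_cylinder[OF p_bounds, of "{j \<in> B. Suc n < j}" ?T "Suc n" "Suc n \<notin> B", OF _ _ _ disj]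
  show "flip (Suc n) (lex_initial B \<inter> tied B (Suc n)) \<in> events"
    unfolding lex_initial_tied[OF B] by (rule flip) auto
  show "bernoulli_weight p (Suc n \<notin> B) * prob (flip (Suc n) (lex_initial B \<inter> tied B (Suc n))) =
    bernoulli_weight p (Suc n \<in> B) * prob (lex_initial B \<inter> tied B (Suc n))"
    unfolding lex_initial_tied[OF B] by (subst flip) auto
qed

text \<open>Pivotal sets lie in \<open>?A\<close> or its flip, and
  \<open>p * prob (flip (Suc n) ?A) = (1 - p) * prob ?A\<close>, so the two contributions add up to
  \<open>prob ?A\<close>.\<close>

lemma influence_lex_initial_out:
  assumes "Suc n \<notin> B"
  shows "p * influence (biased_seq p) (lex_initial B) (Suc n) \<le> prob (lex_initial B \<inter> tied B (Suc n))"
proof -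
  let ?A = "lex_initial B \<inter> tied B (Suc n)"
  have "influence (biased_seq p) (lex_initial B) (Suc n) \<le> prob (?A \<union> flip (Suc n) ?A)"
    unfolding influence_def card_pivotal space_biased_seq
    using pivotal_lex_initial[OF B] assms prob_flip_lex_initial_tied(1) lex_initial_in_sets tied_in_sets
    by (intro finite_measure_mono) (auto simp: flip_Int)
  also have "\<dots> \<le> prob ?A + prob (flip (Suc n) ?A)"
    using prob_flip_lex_initial_tied(1) lex_initial_in_sets tied_in_sets
    by (intro measure_Un_le) auto
  finally have "p * influence (biased_seq p) (lex_initial B) (Suc n) \<le>
      p * prob ?A + p * prob (flip (Suc n) ?A)" using p by (simp flip: distrib_left)
  then show ?thesis using prob_flip_lex_initial_tied(2)[of n] assms
    by (simp add: bernoulli_weight_def algebra_simps)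
qed

text \<open>Here the tied partner must lie outside the family, so \<open>?A\<close> and its flip are
  removed from \<open>tied B n\<close>; their joint measure times \<open>1 - p\<close> is
  \<open>prob ?A\<close>.\<close>

lemma influence_lex_initial_in:
  assumes "Suc n \<in> B"
  shows "(1 - p) * influence (biased_seq p) (lex_initial B) (Suc n) \<le>
    (1 - p) * prob (tied B n) - prob (lex_initial B \<inter> tied B (Suc n))"
proof -
  let ?A = "lex_initial B \<inter> tied B (Suc n)"
  let ?X = "tied B (Suc n) - ?A" and ?Y = "flip (Suc n) (tied B (Suc n)) - flip (Suc n) ?A"
  have ev: "?X \<in> events" "?Y \<in> events"
    using prob_flip_lex_initial_tied(1) lex_initial_in_sets tied_in_sets by auto
  have "influence (biased_seq p) (lex_initial B) (Suc n) \<le> prob (?X \<union> ?Y)"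
    unfolding influence_def card_pivotal space_biased_seq
    using pivotal_lex_initial[OF B] assms ev
    by (intro finite_measure_mono) (auto simp: flip_Int)
  also have "\<dots> \<le> prob ?X + prob ?Y"
    using ev by (intro measure_Un_le)
  also have "prob ?X = prob (tied B (Suc n)) - prob ?A"
    using lex_initial_in_sets tied_in_sets by (intro finite_measure_Diff) auto
  also have "prob ?Y = prob (flip (Suc n) (tied B (Suc n))) - prob (flip (Suc n) ?A)"
    using prob_flip_lex_initial_tied(1) tied_in_sets by (intro finite_measure_Diff) (auto simp: flip_Int)
  also have "prob (tied B (Suc n)) - prob ?A + (prob (flip (Suc n) (tied B (Suc n))) - prob (flip (Suc n) ?A))
      = prob (tied B n) - prob ?A - prob (flip (Suc n) ?A)"
    unfolding prob_tied_Suc using assms by (simp add: bernoulli_weight_def algebra_simps)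
  finally have "(1 - p) * influence (biased_seq p) (lex_initial B) (Suc n) \<le>
      (1 - p) * (prob (tied B n) - prob ?A - prob (flip (Suc n) ?A))" using p by simp
  then show ?thesis using prob_flip_lex_initial_tied(2)[of n] assms
    by (simp add: bernoulli_weight_def algebra_simps)
qed

lemma prob_lex_initial_tied:
  "prob (lex_initial B \<inter> tied B n) = prob (lex_initial B \<inter> tied B (Suc n)) +
    (if Suc n \<in> B then p * prob (tied B n) else 0)"
proof -
  let ?W = "flip (Suc n) (tied B (Suc n))"
  have e: "lex_initial B \<inter> tied B n = (lex_initial B \<inter> tied B (Suc n)) \<union> (if Suc n \<in> B then ?W else {})"
    unfolding tied_Suc[of B n] using flip_tied_mem_lex_initial[OF B, of _ n] by auto
  have "tied B (Suc n) \<inter> ?W = {}"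
    unfolding flip_tied unfolding tied_def cylinder_def by auto
  then have "prob (lex_initial B \<inter> tied B n) = prob (lex_initial B \<inter> tied B (Suc n)) +
      prob (if Suc n \<in> B then ?W else {})"
    unfolding e using lex_initial_in_sets tied_in_sets by (intro finite_measure_Union) auto
  then show ?thesis by (simp add: prob_tied_Suc bernoulli_weight_def)
qed

text \<open>Conditioned on \<open>tied B n\<close>, the family is again lexicographic in the
  coordinates after \<open>n\<close>. The quotient is its conditional measure, and reading
  \<open>Suc n\<close> performs one step of the profile recursion: high if
  \<open>Suc n \<in> B\<close>, low otherwise.\<close>

lemma sum_influence_lex_initial_tied:
  "(\<Sum>i<k. influence (biased_seq p) (lex_initial B) (Suc (n + i))) \<le>
    prob (tied B n) * lex_profile p k (prob (lex_initial B \<inter> tied B n) / prob (tied B n))"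
proof (induction k arbitrary: n)
  case (Suc k)
  let ?I = "influence (biased_seq p) (lex_initial B)"
  define w where "w = prob (tied B n)"
  define w' where "w' = prob (tied B (Suc n))"
  define t where "t = prob (lex_initial B \<inter> tied B (Suc n)) / w'"
  have w: "0 < w" "0 < w'" by (simp_all add: w_def w'_def prob_tied_pos)
  have A: "prob (lex_initial B \<inter> tied B (Suc n)) = w' * t" using w by (simp add: t_def)
  have t: "0 \<le> t" "t \<le> 1" using w tied_in_sets
    by (auto simp: t_def w'_def divide_le_eq intro!: finite_measure_mono)
  have "(\<Sum>i<Suc k. ?I (Suc (n + i))) = ?I (Suc n) + (\<Sum>i<k. ?I (Suc (Suc n + i)))"
    by (subst sum.lessThan_Suc_shift) simp
  also have "\<dots> \<le> ?I (Suc n) + w' * lex_profile p k t"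
    using Suc.IH[of "Suc n"] by (simp add: w'_def t_def)
  also have "\<dots> \<le> w * lex_profile p (Suc k) (prob (lex_initial B \<inter> tied B n) / w)"
  proof (cases "Suc n \<in> B")
    case True
    have w': "w' = (1 - p) * w"
      using prob_tied_Suc(1)[of n] True by (simp add: w_def w'_def bernoulli_weight_def)
    have "prob (lex_initial B \<inter> tied B n) = w * (p + (1 - p) * t)"
      using prob_lex_initial_tied[of n] True unfolding A w' by (simp add: w_def algebra_simps)
    then have m: "prob (lex_initial B \<inter> tied B n) / w = p + (1 - p) * t" using w by simp
    have "(1 - p) * ?I (Suc n) \<le> (1 - p) * (w * (1 - t))"
      using influence_lex_initial_in[OF True] unfolding A w' by (simp add: w_def algebra_simps)
    then have "?I (Suc n) \<le> w * (1 - t)" using p by simp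
    moreover have T: "lex_step p (lex_profile p k) (p + (1 - p) * t) = (1 - p) * lex_profile p k t + 1 - t"
      using p t by (intro lex_step_high) (auto simp: lex_profile_0 lex_profile_1)
    ultimately show ?thesis unfolding m w' lex_profile.simps T by (simp add: algebra_simps)
  next
    case False
    have w': "w' = p * w"
      using prob_tied_Suc(1)[of n] False by (simp add: w_def w'_def bernoulli_weight_def)
    have "prob (lex_initial B \<inter> tied B n) = w * (p * t)"
      using prob_lex_initial_tied[of n] False unfolding A w' by (simp add: algebra_simps)
    then have m: "prob (lex_initial B \<inter> tied B n) / w = p * t" using w by simp
    have "p * ?I (Suc n) \<le> p * (w * t)"
      using influence_lex_initial_out[OF False] unfolding A w' by (simp add: algebra_simps)
    then have "?I (Suc n) \<le> w * t" using p by simp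
    moreover have T: "lex_step p (lex_profile p k) (p * t) = p * lex_profile p k t + t"
      using p t by (intro lex_step_low)
    ultimately show ?thesis unfolding m w' lex_profile.simps T by (simp add: algebra_simps)
  qed
  finally show ?case by (simp add: w_def)
qed simp

lemma sum_influence_lex_initial:
  "(\<Sum>i<k. influence (biased_seq p) (lex_initial B) (Suc i)) \<le>
    lex_profile p k (prob (lex_initial B))"
proof -
  \<comment> \<open>Before any coordinate is read, every set is tied.\<close>
  have e: "tied B 0 = space (biased_seq p)" by (auto simp: tied_def cylinder_def)
  have "lex_initial B \<inter> tied B 0 = lex_initial B"
    by (auto simp: lex_initial_def tied_def cylinder_def)
  moreover have "prob (tied B 0) = 1" unfolding e by (rule prob_space)
  ultimately show ?thesis using sum_influence_lex_initial_tied[where k = k and n = 0] by simp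
qed

end

section \<open>Comparison of total influences\<close>

lemma total_influence_seq_eq_0:
  assumes "\<And>S i. S \<subseteq> {1..} \<Longrightarrow> 1 \<le> i \<Longrightarrow> S \<in> F \<longleftrightarrow> sym_diff S {i} \<in> F"
  shows "total_influence_seq p F = 0"
proof -
  have *: "{S \<in> Pow {1..}. (S \<in> F) \<noteq> (sym_diff S {Suc i} \<in> F)} = {}" for i
    using assms[of _ "Suc i"] by auto
  then have "influence (biased_seq p) F (Suc i) = 0" for i
    unfolding influence_def card_pivotal space_biased_seq * by simp
  then show ?thesis by (simp add: total_influence_seq_def)
qed

theorem theorem1p9:
  fixes p lam :: real and n :: nat and F :: "nat set set"
  assumes "0 < p" and "p < 1"
    and "1 \<le> n"
    and "monotone_increasing n F"
    and "0 \<le> lam" and "lam \<le> 1"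
    and "measure (biased_fin p n) F = measure (biased_seq p) (lex_family lam)"
  shows "ennreal (total_influence_fin p n F) \<ge> total_influence_seq p (lex_family lam)"
proof (cases "lam = 0 \<or> lam = 1")
  case True
  then have "lex_family lam = {} \<or> lex_family lam = Pow {1..}" by (auto simp: lex_family_def)
  then have "total_influence_seq p (lex_family lam) = 0" by (intro total_influence_seq_eq_0) auto
  then show ?thesis by simp
next
  case False
  define B where "B = binary_positions lam"
  have "0 < lam" "lam < 1" using False assms by auto
  then have B: "B \<subseteq> {1..}"
    using is_binary_expansion_binary_positions by (simp add: B_def is_binary_expansion_def)
  have L: "lex_family lam = lex_initial B"
    using False by (simp add: lex_family_def lex_initial_def cylinder_def B_def)
  \<comment> \<open>The infinite sum is the supremum of its partial sums. Each is bounded through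
    the profile at the common measure of the two families.\<close>
  have "(\<Sum>i<k. ennreal (influence (biased_seq p) (lex_initial B) (Suc i)))
      \<le> ennreal (total_influence_fin p n F)" for k
  proof -
    have "(\<Sum>i<k. influence (biased_seq p) (lex_initial B) (Suc i))
        \<le> lex_profile p k (measure (biased_seq p) (lex_initial B))"
      by (rule sum_influence_lex_initial) (use assms B in auto)
    also have "\<dots> = lex_profile p k (measure (biased_fin p n) F)" using assms L by simp
    also have "\<dots> \<le> total_influence_fin p n F"
      using assms by (intro lex_profile_le_total_influence_fin)
    finally show ?thesis by (simp add: sum_ennreal influence_def ennreal_leI)
  qed
  then show ?thesis
    unfolding total_influence_seq_def L suminf_eq_SUP by (intro SUP_least)
qed

end
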